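(* Let $\mathcal{M}^2$ be one of $\mathbb{R}^2$, $\mathbb{H}^2$, $\mathbb{S}^2$, and let $D>0$ (with $D<\pi$ if $\mathcal{M}^2=\mathbb{S}^2$). There exist $\tilde{\varepsilon}>0$ and a constant $c_G>0$ depending only on $D$ (and on $\mathcal{M}^2$) such that the following holds. If $K$ and $L$ are convex bodies in $\mathcal{M}^2$ with $\max\{\operatorname{diam}K,\operatorname{diam}L\}=D$, where in the case $\mathcal{M}^2=\mathbb{S}^2$ it is also assumed that $K\cup L$ is contained in an open hemisphere, and if $\delta(K,L)<\tilde{\varepsilon}$, then $$\Delta(K,L)\le c_G\cdot\delta(K,L).$$
   Context: $\mathbb{R}^2$, $\mathbb{H}^2$, $\mathbb{S}^2$ are the Euclidean plane, the hyperbolic plane (curvature $-1$) and the unit sphere (curvature $1$), with geodesic metric $d$ and the usual area. A set is convex if it contains the geodesic segment joining any two of its points (in $\mathbb{S}^2$ it is moreover required to be contained in an open hemisphere). A convex body is a compact convex set with non-empty interior. $\operatorname{diam}$ is the diameter with respect to $d$. $\delta(A,B)=\max\{\sup_{a\in A}d(a,B),\sup_{b\in B}d(b,A)\}$ is the Hausdorff distance and $\Delta(A,B)=\operatorname{area}(A\cup B)-\operatorname{area}(A\cap B)$ is the symmetric difference distance. *)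

theory Defs
  imports "HOL-Analysis.Analysis"
begin

text \<open>
  A surface is given by a model: a subset of an ambient topological type, the geodesic
  distance and the area measure.  The metric topology of each of the three models below is
  the subspace topology, so compactness and interior refer to the latter.
  Values of \<^term>\<open>dist_fun M\<close> outside \<^term>\<open>points M\<close> are irrelevant.
\<close>

record 'a surface =
  points :: "'a set"
  dist_fun :: "'a \<Rightarrow> 'a \<Rightarrow> real"
  area_measure :: "'a measure"

text \<open>The Lebesgue measure restricted to Borel sets, which suffices since areas are only taken
  of compact sets.\<close>

definition euclidean_plane :: "(real ^ 2) surface" where
  "euclidean_plane = \<lparr>points = UNIV, dist_fun = dist, area_measure = lborel\<rparr>"

text \<open>The upper half-plane with the Riemannian metric \<open>(dx\<^sup>2 + dy\<^sup>2) / y\<^sup>2\<close> of curvature \<open>-1\<close>.\<close>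

definition hyperbolic_plane :: "complex surface" where
  "hyperbolic_plane =
     \<lparr>points = {z. Im z > 0},
      dist_fun = (\<lambda>z w. arcosh (1 + (cmod (z - w))\<^sup>2 / (2 * Im z * Im w))),
      area_measure = density lborel (\<lambda>z. indicator {z. Im z > 0} z * ennreal (1 / (Im z)\<^sup>2))\<rparr>"

text \<open>Spherical coordinates: polar angle \<open>\<theta>\<close>, azimuth \<open>\<phi>\<close>; the area element is
  \<open>sin \<theta> d\<theta> d\<phi>\<close>.\<close>

definition sph_coords :: "real \<times> real \<Rightarrow> real ^ 3" where
  "sph_coords = (\<lambda>(\<theta>, \<phi>). vector [sin \<theta> * cos \<phi>, sin \<theta> * sin \<phi>, cos \<theta>])"

definition unit_sphere :: "(real ^ 3) surface" where
  "unit_sphere =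
     \<lparr>points = sphere 0 1,
      dist_fun = (\<lambda>x y. arccos (x \<bullet> y)),
      area_measure =
        distr (density lborel
                 (\<lambda>p. indicator ({0..pi} \<times> {0..<2 * pi}) p * ennreal (sin (fst p))))
              borel sph_coords\<rparr>"

lemma sph_coords_measurable [measurable]: "sph_coords \<in> borel_measurable borel"
proof -
  have eq: "sph_coords = (\<lambda>p. \<chi> i. if i = 1 then sin (fst p) * cos (snd p)
                             else if i = 2 then sin (fst p) * sin (snd p) else cos (fst p))"
    by (auto simp: sph_coords_def fun_eq_iff vec_eq_iff forall_3)
  have cont: "continuous_on UNIV (\<lambda>p :: real \<times> real. if i = 1 then sin (fst p) * cos (snd p)
                   else if i = 2 then sin (fst p) * sin (snd p) else cos (fst p))"
    for i :: 3
    by (cases "i = 1"; cases "i = 2") (auto intro!: continuous_intros)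
  have "continuous_on UNIV sph_coords"
    unfolding eq by (rule continuous_on_vec_lambda, rule cont)
  then show ?thesis
    by (rule borel_measurable_continuous_onI)
qed

text \<open>Minimizing unit-speed geodesics, as isometric images of an interval.\<close>

definition geodesic :: "'a surface \<Rightarrow> 'a \<Rightarrow> 'a \<Rightarrow> (real \<Rightarrow> 'a) \<Rightarrow> bool" where
  "geodesic M x y \<gamma> \<longleftrightarrow>
     (let l = dist_fun M x y in
        \<gamma> 0 = x \<and> \<gamma> l = y \<and> \<gamma> ` {0..l} \<subseteq> points M \<and>
        (\<forall>s\<in>{0..l}. \<forall>t\<in>{0..l}. dist_fun M (\<gamma> s) (\<gamma> t) = \<bar>s - t\<bar>))"

definition geo_convex :: "'a surface \<Rightarrow> 'a set \<Rightarrow> bool" where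
  "geo_convex M K \<longleftrightarrow>
     K \<subseteq> points M \<and>
     (\<forall>x\<in>K. \<forall>y\<in>K. \<forall>\<gamma>. geodesic M x y \<gamma> \<longrightarrow> \<gamma> ` {0..dist_fun M x y} \<subseteq> K)"

definition convex_body :: "'a::topological_space surface \<Rightarrow> 'a set \<Rightarrow> bool" where
  "convex_body M K \<longleftrightarrow>
     geo_convex M K \<and> compact K \<and> (top_of_set (points M)) interior_of K \<noteq> {}"

definition in_open_hemisphere :: "(real ^ 3) set \<Rightarrow> bool" where
  "in_open_hemisphere A \<longleftrightarrow> (\<exists>u. u \<noteq> 0 \<and> A \<subseteq> {x \<in> sphere 0 1. u \<bullet> x > 0})"

definition spherical_convex_body :: "(real ^ 3) set \<Rightarrow> bool" where
  "spherical_convex_body K \<longleftrightarrow> convex_body unit_sphere K \<and> in_open_hemisphere K"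

definition diam :: "'a surface \<Rightarrow> 'a set \<Rightarrow> real" where
  "diam M A = (SUP (a, b) \<in> A \<times> A. dist_fun M a b)"

definition dist_to_set :: "'a surface \<Rightarrow> 'a \<Rightarrow> 'a set \<Rightarrow> real" where
  "dist_to_set M a B = (INF b\<in>B. dist_fun M a b)"

definition hausdorff_dist :: "'a surface \<Rightarrow> 'a set \<Rightarrow> 'a set \<Rightarrow> real" where
  "hausdorff_dist M A B =
     max (SUP a\<in>A. dist_to_set M a B) (SUP b\<in>B. dist_to_set M b A)"

definition area :: "'a surface \<Rightarrow> 'a set \<Rightarrow> real" where
  "area M A = measure (area_measure M) A"

definition symm_diff_dist :: "'a surface \<Rightarrow> 'a set \<Rightarrow> 'a set \<Rightarrow> real" where
  "symm_diff_dist M A B = area M (A \<union> B) - area M (A \<inter> B)"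

text \<open>In the Euclidean plane the general notions are those of the library.\<close>

lemma geo_convex_euclidean_plane: "geo_convex euclidean_plane K \<longleftrightarrow> convex K"
proof
  assume K: "geo_convex euclidean_plane K"
  show "convex K"
    unfolding convex_contains_segment
  proof (intro ballI)
    fix x y assume xy: "x \<in> K" "y \<in> K"
    show "closed_segment x y \<subseteq> K"
    proof (cases "x = y")
      case True
      with xy show ?thesis by simp
    next
      case False
      define \<gamma> where "\<gamma> = (\<lambda>t. x + (t / dist x y) *\<^sub>R (y - x))"
      have d: "dist x y > 0" using False by simp
      have iso: "dist (\<gamma> s) (\<gamma> t) = \<bar>s - t\<bar>" for s t
      proof -
        have "\<gamma> s - \<gamma> t = ((s - t) / dist x y) *\<^sub>R (y - x)"
          by (simp add: \<gamma>_def algebra_simps diff_divide_distrib)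
        then have "dist (\<gamma> s) (\<gamma> t) = \<bar>(s - t) / dist x y\<bar> * norm (y - x)"
          by (metis dist_norm norm_scaleR)
        with d show ?thesis by (simp add: dist_norm norm_minus_commute)
      qed
      have "geodesic euclidean_plane x y \<gamma>"
        using d iso by (simp add: geodesic_def euclidean_plane_def Let_def \<gamma>_def)
      with K xy have sub: "\<gamma> ` {0..dist x y} \<subseteq> K"
        by (auto simp: geo_convex_def euclidean_plane_def)
      show ?thesis
      proof
        fix z assume "z \<in> closed_segment x y"
        then obtain u where u: "0 \<le> u" "u \<le> 1" "z = (1 - u) *\<^sub>R x + u *\<^sub>R y"
          by (auto simp: in_segment)
        have "z = \<gamma> (u * dist x y)" using d u by (simp add: \<gamma>_def algebra_simps)
        moreover have "u * dist x y \<in> {0..dist x y}"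
          using u d by (simp add: mult_left_le_one_le)
        ultimately show "z \<in> K" using sub by blast
      qed
    qed
  qed
next
  assume K: "convex K"
  show "geo_convex euclidean_plane K"
    unfolding geo_convex_def
  proof (intro conjI ballI allI impI subsetI)
    show "z \<in> points euclidean_plane" for z by (simp add: euclidean_plane_def)
    fix x y \<gamma> z
    assume xy: "x \<in> K" "y \<in> K" and g: "geodesic euclidean_plane x y \<gamma>"
      and "z \<in> \<gamma> ` {0..dist_fun euclidean_plane x y}"
    then obtain t where t: "0 \<le> t" "t \<le> dist x y" "z = \<gamma> t"
      by (auto simp: euclidean_plane_def)
    have ends: "\<gamma> 0 = x" "\<gamma> (dist x y) = y"
      and iso: "\<And>s t. \<lbrakk>s \<in> {0..dist x y}; t \<in> {0..dist x y}\<rbrakk> \<Longrightarrow> dist (\<gamma> s) (\<gamma> t) = \<bar>s - t\<bar>"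
      using g by (auto simp: geodesic_def euclidean_plane_def Let_def)
    have "dist x z = t" "dist z y = dist x y - t"
      using iso[of 0 t] iso[of t "dist x y"] t ends by auto
    then have "between (x, y) z" by (simp add: between)
    then have "z \<in> closed_segment x y" by (simp add: between_mem_segment)
    with K xy show "z \<in> K" by (auto simp: convex_contains_segment)
  qed
qed

lemma convex_body_euclidean_plane:
  "convex_body euclidean_plane K \<longleftrightarrow> convex K \<and> compact K \<and> interior K \<noteq> {}"
proof -
  have "(top_of_set (points euclidean_plane)) interior_of K = interior K"
    by (auto simp: euclidean_plane_def interior_of_def interior_def)
  then show ?thesis
    by (simp add: convex_body_def geo_convex_euclidean_plane)
qed

lemma diam_euclidean_plane: "A \<noteq> {} \<Longrightarrow> diam euclidean_plane A = diameter A"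
  by (simp add: diam_def diameter_def euclidean_plane_def)

lemma dist_to_set_euclidean_plane:
  "B \<noteq> {} \<Longrightarrow> dist_to_set euclidean_plane a B = infdist a B"
  by (simp add: dist_to_set_def infdist_def euclidean_plane_def)

end

theory Submission
  imports Defs
begin

text \<open>
  Each of the three planes has a chart in \<open>\<real>\<^sup>2\<close> in which geodesic segments become straight: a translation,
  the map \<open>(x, y) \<mapsto> (x, x\<^sup>2 + y\<^sup>2)\<close> of the half-plane, and central projection of the sphere. So convex
  bodies become planar convex sets, and a point of \<open>L\<close> outside \<open>K\<close> is separated from \<open>K\<close> by a line.
  Consider the points for which that line has slope at most 1 and \<open>K\<close> lies below it. If every point of \<open>L\<close> is
  within \<open>h\<close> of \<open>K\<close>, two such points with abscissas at most \<open>h\<close> apart differ in height by at most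
  \<open>3 h\<close> (\<open>upper_points_covered\<close>): such points form a Lipschitz graph thickened by \<open>O(h)\<close>. The other
  positions of the line differ by a symmetry of the coordinate axes. Hence \<open>L - K\<close> is covered by \<open>O(1 / h)\<close> sets of size
  \<open>3 h\<close> in the chart (\<open>difference_covered\<close>). A set of size \<open>r\<close> has area \<open>O(r\<^sup>2)\<close>, so the total area
  is \<open>O(h)\<close>, and \<open>h\<close> may be any number above a multiple of the Hausdorff distance
  (\<open>symm_diff_dist_bound\<close>).

  For the constants to depend on \<open>D\<close> only, the bodies must be brought to a region of the chart on which
  its distortion is controlled by \<open>D\<close>. In the half-plane this is a translation and a dilation that put a
  point of \<open>K\<close> at a fixed place, since the rest of \<open>K\<close> is then at distance at most \<open>D\<close>. On the sphere, a
  convex body of diameter at most \<open>D < \<pi>\<close> must be shown to lie in a cap whose radius is bounded away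
  from \<open>\<pi> / 2\<close> (\<open>spherical_body_in_cap\<close>): a body that fits into no such cap has the origin close to
  its convex hull, and then convexity gives it two nearly antipodal points.
\<close>

section \<open>Outer measure bounds\<close>

text \<open>Outer measure at most \<open>a\<close>. Working with covers avoids any measurability question
  about the pieces into which the difference of two bodies is cut below.\<close>

definition covered_within :: "'a measure \<Rightarrow> real \<Rightarrow> 'a set \<Rightarrow> bool" where
  "covered_within \<mu> a S \<longleftrightarrow> (\<exists>B\<in>sets \<mu>. S \<subseteq> B \<and> emeasure \<mu> B \<le> ennreal a)"

lemma covered_within_empty: "covered_within \<mu> a {}"
  unfolding covered_within_def by (intro bexI[of _ "{}"]) auto

lemma covered_within_mono:
  "covered_within \<mu> a S \<Longrightarrow> S' \<subseteq> S \<Longrightarrow> a \<le> a' \<Longrightarrow> covered_within \<mu> a' S'"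
  unfolding covered_within_def by (meson dual_order.trans ennreal_leI)

lemma covered_within_UN:
  assumes "finite I" "0 \<le> a" "\<And>i. i \<in> I \<Longrightarrow> covered_within \<mu> a (S i)"
  shows "covered_within \<mu> (real (card I) * a) (\<Union>i\<in>I. S i)"
proof -
  obtain B where B: "\<And>i. i \<in> I \<Longrightarrow> B i \<in> sets \<mu> \<and> S i \<subseteq> B i \<and> emeasure \<mu> (B i) \<le> ennreal a"
    using assms(3) unfolding covered_within_def by metis
  have "emeasure \<mu> (\<Union>i\<in>I. B i) \<le> (\<Sum>i\<in>I. emeasure \<mu> (B i))"
    using B assms(1) by (intro emeasure_subadditive_finite) auto
  also have "\<dots> \<le> (\<Sum>i\<in>I. ennreal a)"
    using B by (intro sum_mono) auto
  also have "\<dots> = ennreal (real (card I) * a)"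
    using assms(2) by (simp add: ennreal_mult ennreal_of_nat_eq_real_of_nat)
  finally show ?thesis
    unfolding covered_within_def using B assms(1)
    by (intro bexI[of _ "\<Union>i\<in>I. B i"]) (auto intro!: sets.finite_UN)
qed

lemma covered_within_Un:
  assumes "covered_within \<mu> a S" "covered_within \<mu> b T" "0 \<le> a" "0 \<le> b"
  shows "covered_within \<mu> (a + b) (S \<union> T)"
proof -
  obtain B C where B: "B \<in> sets \<mu>" "S \<subseteq> B" "emeasure \<mu> B \<le> ennreal a"
    and C: "C \<in> sets \<mu>" "T \<subseteq> C" "emeasure \<mu> C \<le> ennreal b"
    using assms unfolding covered_within_def by blast
  have "emeasure \<mu> (B \<union> C) \<le> ennreal a + ennreal b"
    using emeasure_subadditive[OF B(1) C(1)] B(3) C(3) by (meson add_mono order_trans)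
  then show ?thesis
    unfolding covered_within_def using B C assms
    by (intro bexI[of _ "B \<union> C"]) (auto simp: ennreal_plus)
qed

lemma covered_within_measure_le:
  assumes "covered_within \<mu> a S" "0 \<le> a"
  shows "measure \<mu> S \<le> a"
proof (cases "S \<in> sets \<mu>")
  case True
  obtain B where B: "B \<in> sets \<mu>" "S \<subseteq> B" "emeasure \<mu> B \<le> ennreal a"
    using assms unfolding covered_within_def by blast
  have "emeasure \<mu> S \<le> ennreal a"
    using emeasure_mono[OF B(2,1)] B(3) by order
  then show ?thesis
    using assms(2) by (simp add: measure_def enn2real_leI)
next
  case False
  then show ?thesis using assms(2) by (simp add: measure_notin_sets)
qed

section \<open>Covering the difference of two nearby planar convex sets\<close>

text \<open>The cone condition defining the set says that \<open>K\<close> stays below the upward cone of slope 1 with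
  apex \<open>z\<close>. Two such points \<open>x\<close>, \<open>y\<close> in the same vertical strip of width \<open>h\<close> therefore have almost the
  same height: \<open>y\<close> is within \<open>h\<close> of a point \<open>p\<close> of \<open>K\<close>, and \<open>p\<close>, whose abscissa is within
  \<open>2 h\<close> of that of \<open>x\<close>, is no higher than \<open>\<beta> x + 2 h\<close>. So each of the at most \<open>2 R / h + 1\<close> strips
  contributes one set of size \<open>3 h\<close>. Leaving \<open>\<alpha>\<close> and \<open>\<beta>\<close> free lets the statement serve both axes
  and both orientations.\<close>

lemma upper_points_covered:
  fixes \<alpha> \<beta> :: "'a \<Rightarrow> real"
  assumes h: "0 < h" and b: "0 \<le> b" and R: "0 \<le> R"
    and near: "\<And>z. z \<in> L \<Longrightarrow> \<exists>p\<in>K. \<bar>\<alpha> p - \<alpha> z\<bar> \<le> h \<and> \<bar>\<beta> p - \<beta> z\<bar> \<le> h"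
    and bnd: "\<And>z. z \<in> L \<Longrightarrow> \<bar>\<alpha> z\<bar> \<le> R"
    and small: "\<And>S. S \<subseteq> L \<Longrightarrow> \<forall>x\<in>S. \<forall>y\<in>S. \<bar>\<alpha> x - \<alpha> y\<bar> \<le> 3 * h \<and> \<bar>\<beta> x - \<beta> y\<bar> \<le> 3 * h \<Longrightarrow>
                  covered_within \<mu> (b * h\<^sup>2) S"
  shows "covered_within \<mu> (b * (2 * R + h) * h) {z \<in> L. \<forall>p\<in>K. \<beta> p \<le> \<beta> z + \<bar>\<alpha> p - \<alpha> z\<bar>}"
    (is "covered_within \<mu> _ ?T")
proof -
  define S where "S i = {z \<in> ?T. nat \<lfloor>(\<alpha> z + R) / h\<rfloor> = i}" for i
  define n where "n = nat \<lfloor>2 * R / h\<rfloor>"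
  have small_S: "covered_within \<mu> (b * h\<^sup>2) (S i)" for i
  proof (rule small)
    show "S i \<subseteq> L" by (auto simp: S_def)
    have a: "\<bar>\<alpha> x - \<alpha> y\<bar> \<le> h" if "x \<in> S i" "y \<in> S i" for x y
    proof -
      have "\<bar>\<alpha> x\<bar> \<le> R" "\<bar>\<alpha> y\<bar> \<le> R" using bnd that by (auto simp: S_def)
      then have "0 \<le> (\<alpha> x + R) / h" "0 \<le> (\<alpha> y + R) / h" using h by auto
      moreover have "nat \<lfloor>(\<alpha> x + R) / h\<rfloor> = nat \<lfloor>(\<alpha> y + R) / h\<rfloor>"
        using that by (auto simp: S_def)
      ultimately have "\<lfloor>(\<alpha> x + R) / h\<rfloor> = \<lfloor>(\<alpha> y + R) / h\<rfloor>"
        by (metis eq_nat_nat_iff zero_le_floor)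
      then have "\<bar>(\<alpha> x + R) / h - (\<alpha> y + R) / h\<bar> \<le> 1" by linarith
      then have "\<bar>(\<alpha> x - \<alpha> y) / h\<bar> \<le> 1" by (simp add: diff_divide_distrib add_divide_distrib)
      then show ?thesis using h by (simp add: abs_divide)
    qed
    have "\<beta> y \<le> \<beta> x + 3 * h" if xy: "x \<in> S i" "y \<in> S i" for x y
    proof -
      have "y \<in> L" using xy by (simp add: S_def)
      then obtain p where p: "p \<in> K" "\<bar>\<alpha> p - \<alpha> y\<bar> \<le> h" "\<bar>\<beta> p - \<beta> y\<bar> \<le> h" 
        using near by blast
      have "\<beta> p \<le> \<beta> x + \<bar>\<alpha> p - \<alpha> x\<bar>" using xy p(1) by (simp add: S_def)
      then show ?thesis using p a[OF xy] by linarith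
    qed
    then show "\<forall>x\<in>S i. \<forall>y\<in>S i. \<bar>\<alpha> x - \<alpha> y\<bar> \<le> 3 * h \<and> \<bar>\<beta> x - \<beta> y\<bar> \<le> 3 * h"
      using a h by (smt (verit))
  qed
  have cov: "covered_within \<mu> (real (card {..n}) * (b * h\<^sup>2)) (\<Union>i\<in>{..n}. S i)"
    using b small_S by (intro covered_within_UN) auto
  show ?thesis
  proof (rule covered_within_mono[OF cov])
    show "?T \<subseteq> (\<Union>i\<in>{..n}. S i)"
    proof
      fix z assume z: "z \<in> ?T"
      then have "(\<alpha> z + R) / h \<le> 2 * R / h" using h bnd[of z] by (intro divide_right_mono) auto
      then have "nat \<lfloor>(\<alpha> z + R) / h\<rfloor> \<le> n" unfolding n_def by (intro nat_mono floor_mono)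
      then show "z \<in> (\<Union>i\<in>{..n}. S i)" using z by (auto simp: S_def)
    qed
    have "real n \<le> 2 * R / h" unfolding n_def using h R by simp
    then have "real (card {..n}) * h \<le> (2 * R / h + 1) * h" using h by (intro mult_right_mono) auto
    then have "real (card {..n}) * h \<le> 2 * R + h" using h by (simp add: algebra_simps)
    then have "(b * h) * (real (card {..n}) * h) \<le> (b * h) * (2 * R + h)" using b h by (intro mult_left_mono) auto
    then show "real (card {..n}) * (b * h\<^sup>2) \<le> b * (2 * R + h) * h"
      by (simp add: power2_eq_square mult_ac)
  qed
qed

text \<open>A separating line has a normal vector with a dominant coordinate; its axis and its sign give the
  four cases.\<close>

lemma outside_convex_cases:
  fixes P :: "(real \<times> real) set"
  assumes "convex P" "z \<notin> P"
  obtains "\<forall>p\<in>P. snd p \<le> snd z + \<bar>fst p - fst z\<bar>"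
  | "\<forall>p\<in>P. - snd p \<le> - snd z + \<bar>fst p - fst z\<bar>"
  | "\<forall>p\<in>P. fst p \<le> fst z + \<bar>snd p - snd z\<bar>"
  | "\<forall>p\<in>P. - fst p \<le> - fst z + \<bar>snd p - snd z\<bar>"
proof (cases "P = {}")
  case True
  then show ?thesis using that by auto
next
  case False
  then obtain n c where n: "n \<noteq> 0" "\<And>p. p \<in> P \<Longrightarrow> n \<bullet> p \<le> c" "n \<bullet> z \<ge> c"
    using separating_hyperplane_sets[OF assms(1) convex_singleton[of z] False] assms(2) by auto
  obtain n1 n2 where n12: "n = (n1, n2)" by (cases n)
  have sep: "n1 * (fst p - fst z) + n2 * (snd p - snd z) \<le> 0" if "p \<in> P" for p
    using n(2)[OF that] n(3) by (simp add: n12 inner_prod_def algebra_simps)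
  \<comment> \<open>The coordinate with the larger coefficient is dominated by the other one.\<close>
  have dom: "v \<le> \<bar>u\<bar>" if "k * u + m * v \<le> 0" "\<bar>k\<bar> \<le> m" "0 < m" for k m u v :: real
  proof -
    have "m * v \<le> \<bar>k\<bar> * \<bar>u\<bar>" using that(1) abs_ge_minus_self[of "k * u"] by (simp add: abs_mult)
    also have "\<dots> \<le> m * \<bar>u\<bar>" using that(2) by (intro mult_right_mono) auto
    finally show ?thesis using that(3) by simp
  qed
  consider "\<bar>n1\<bar> \<le> n2" "0 < n2" | "\<bar>n1\<bar> \<le> - n2" "0 < - n2"
    | "\<bar>n2\<bar> \<le> n1" "0 < n1" | "\<bar>n2\<bar> \<le> - n1" "0 < - n1"
    using n(1) by (auto simp: n12 zero_prod_def) linarith+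
  then show ?thesis
  proof cases
    case 1
    have "snd p - snd z \<le> \<bar>fst p - fst z\<bar>" if "p \<in> P" for p
      using dom[of n1 _ n2] sep[OF that] 1 by blast
    then show ?thesis using that(1) by (simp add: algebra_simps)
  next
    case 2
    have "snd z - snd p \<le> \<bar>fst p - fst z\<bar>" if "p \<in> P" for p
      by (rule dom[of n1 _ "- n2"]) (use sep[OF that] 2 in \<open>auto simp: algebra_simps\<close>)
    then show ?thesis using that(2) by (simp add: algebra_simps)
  next
    case 3
    have "fst p - fst z \<le> \<bar>snd p - snd z\<bar>" if "p \<in> P" for p
      by (rule dom[of n2 _ "n1"]) (use sep[OF that] 3 in \<open>auto simp: algebra_simps\<close>)
    then show ?thesis using that(3) by (simp add: algebra_simps)
  next
    case 4
    have "fst z - fst p \<le> \<bar>snd p - snd z\<bar>" if "p \<in> P" for p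
      by (rule dom[of n2 _ "- n1"]) (use sep[OF that] 4 in \<open>auto simp: algebra_simps\<close>)
    then show ?thesis using that(4) by (simp add: algebra_simps)
  qed
qed

definition chart_close :: "('a \<Rightarrow> real \<times> real) \<Rightarrow> real \<Rightarrow> 'a \<Rightarrow> 'a \<Rightarrow> bool" where
  "chart_close f r x y \<longleftrightarrow> \<bar>fst (f x) - fst (f y)\<bar> \<le> r \<and> \<bar>snd (f x) - snd (f y)\<bar> \<le> r"

text \<open>Each point of \<open>L - K\<close> falls under one of the four directions of
  \<open>outside_convex_cases\<close>, and each direction is handled by \<open>upper_points_covered\<close>.\<close>

lemma difference_covered:
  fixes f :: "'a \<Rightarrow> real \<times> real"
  assumes h: "0 < h" and b: "0 \<le> b" and R: "0 \<le> R"
    and inj: "inj_on f (K \<union> L)" and conv: "convex (f ` K)"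
    and near: "\<And>z. z \<in> L \<Longrightarrow> \<exists>p\<in>K. chart_close f h p z"
    and bnd: "\<And>z. z \<in> L \<Longrightarrow> \<bar>fst (f z)\<bar> \<le> R \<and> \<bar>snd (f z)\<bar> \<le> R"
    and small: "\<And>S r. S \<subseteq> L \<Longrightarrow> 0 < r \<Longrightarrow> \<forall>x\<in>S. \<forall>y\<in>S. chart_close f r x y \<Longrightarrow>
                  covered_within \<mu> (b * r\<^sup>2) S"
  shows "covered_within \<mu> (36 * b * (2 * R + h) * h) (L - K)"
proof -
  define T where "T \<alpha> \<beta> = {z \<in> L. \<forall>p\<in>K. \<beta> p \<le> \<beta> z + \<bar>\<alpha> p - \<alpha> z\<bar>}" for \<alpha> \<beta> :: "'a \<Rightarrow> real"
  define c where "c = 9 * b * (2 * R + h) * h"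
  define x y where "x = (\<lambda>z. fst (f z))" and "y = (\<lambda>z. snd (f z))"
  have c: "0 \<le> c" using h b R by (simp add: c_def)
  have small': "covered_within \<mu> (9 * b * h\<^sup>2) S"
    if "S \<subseteq> L" "\<forall>p\<in>S. \<forall>q\<in>S. chart_close f (3 * h) p q" for S
    using small[of S "3 * h"] that h by (simp add: power_mult_distrib mult_ac)
  have "covered_within \<mu> c (T x y)" "covered_within \<mu> c (T x (\<lambda>z. - y z))"
    "covered_within \<mu> c (T y x)" "covered_within \<mu> c (T y (\<lambda>z. - x z))"
    unfolding c_def T_def
    using h b R near bnd small'
    by (intro upper_points_covered; fastforce simp: x_def y_def chart_close_def abs_minus_commute)+
  then have "covered_within \<mu> ((c + c) + (c + c))
      ((T x y \<union> T x (\<lambda>z. - y z)) \<union> (T y x \<union> T y (\<lambda>z. - x z)))"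
    using c by (intro covered_within_Un) auto
  then show ?thesis
  proof (rule covered_within_mono)
    show "L - K \<subseteq> (T x y \<union> T x (\<lambda>z. - y z)) \<union> (T y x \<union> T y (\<lambda>z. - x z))"
    proof
      fix z assume z: "z \<in> L - K"
      then have "f z \<notin> f ` K" using inj by (auto dest: inj_onD)
      with conv show "z \<in> (T x y \<union> T x (\<lambda>z. - y z)) \<union> (T y x \<union> T y (\<lambda>z. - x z))"
        using z by (cases rule: outside_convex_cases) (auto simp: T_def x_def y_def)
    qed
  qed (simp add: c_def)
qed

section \<open>From Hausdorff distance to area\<close>

lemma hausdorff_dist_nonneg:
  assumes "K \<noteq> {}" "L \<noteq> {}"
    and "\<And>x y. x \<in> K \<Longrightarrow> y \<in> L \<Longrightarrow> 0 \<le> dist_fun M x y"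
    and "\<And>x y. x \<in> K \<Longrightarrow> y \<in> L \<Longrightarrow> dist_fun M x y \<le> E"
  shows "0 \<le> hausdorff_dist M K L"
proof -
  obtain x y where xy: "x \<in> K" "y \<in> L" using assms by auto
  have bb: "bdd_below (dist_fun M u ` L)" if "u \<in> K" for u
    using assms(3)[OF that] by (auto simp: bdd_below_def)
  have "dist_to_set M u L \<le> E" if "u \<in> K" for u
    unfolding dist_to_set_def using cINF_lower2[OF bb[OF that] xy(2)] assms(4)[OF that xy(2)] by auto
  then have "bdd_above ((\<lambda>u. dist_to_set M u L) ` K)" by (auto simp: bdd_above_def)
  moreover have "0 \<le> dist_to_set M x L"
    unfolding dist_to_set_def using assms(2,3) xy by (intro cINF_greatest) auto
  ultimately have "0 \<le> (SUP u\<in>K. dist_to_set M u L)"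
    using xy by (meson cSUP_upper2)
  then show ?thesis by (simp add: hausdorff_dist_def)
qed

text \<open>The bounds on the distances are what makes the suprema and infima over real numbers in
  \<open>hausdorff_dist\<close> meaningful.\<close>

lemma hausdorff_dist_near:
  assumes "K \<noteq> {}" "L \<noteq> {}"
    and pos: "\<And>x y. x \<in> K \<union> L \<Longrightarrow> y \<in> K \<union> L \<Longrightarrow> 0 \<le> dist_fun M x y"
    and bd: "\<And>x y. x \<in> K \<union> L \<Longrightarrow> y \<in> K \<union> L \<Longrightarrow> dist_fun M x y \<le> E"
    and h: "hausdorff_dist M K L < h"
  shows "x \<in> K \<Longrightarrow> \<exists>y\<in>L. dist_fun M x y < h" "y \<in> L \<Longrightarrow> \<exists>x\<in>K. dist_fun M y x < h"
proof -
  have near: "\<exists>y\<in>B. dist_fun M x y < h"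
    if AB: "A \<subseteq> K \<union> L" "B \<subseteq> K \<union> L" "B \<noteq> {}" "x \<in> A" "(SUP a\<in>A. dist_to_set M a B) < h" for A B x
  proof -
    have bb: "bdd_below (dist_fun M u ` B)" if "u \<in> A" for u
      using pos[of u] that AB(1,2) by (intro bdd_belowI2[of _ 0]) blast
    obtain v where v: "v \<in> B" using AB by auto
    have "dist_to_set M u B \<le> E" if "u \<in> A" for u
      unfolding dist_to_set_def using cINF_lower2[OF bb[OF that] v] bd[of u v] AB v that by auto
    then have "bdd_above ((\<lambda>u. dist_to_set M u B) ` A)" by (auto simp: bdd_above_def)
    then have "dist_to_set M x B < h" using AB(4,5) by (meson cSUP_upper order_le_less_trans)
    then show ?thesis
      unfolding dist_to_set_def using cINF_less_iff[OF AB(3) bb[OF AB(4)]] by blast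
  qed
  show "\<exists>y\<in>L. dist_fun M x y < h" if "x \<in> K" 
    using near[of K L x] that h assms by (simp add: hausdorff_dist_def)
  show "\<exists>x\<in>K. dist_fun M y x < h" if "y \<in> L" 
    using near[of L K y] that h assms by (simp add: hausdorff_dist_def)
qed

lemma dist_le_diam:
  assumes "x \<in> K" "y \<in> K" and "\<And>x y. x \<in> K \<Longrightarrow> y \<in> K \<Longrightarrow> dist_fun M x y \<le> E"
  shows "dist_fun M x y \<le> diam M K"
proof -
  have "(\<lambda>(a, b). dist_fun M a b) (x, y) \<le> (SUP (a, b) \<in> K \<times> K. dist_fun M a b)"
    using assms by (intro cSUP_upper) (auto simp: bdd_above_def)
  then show ?thesis by (simp add: diam_def)
qed

lemma symm_diff_dist_le:
  assumes "covered_within (area_measure M) a (K - L)" "covered_within (area_measure M) a (L - K)" "0 \<le> a"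
    and sets: "K \<in> sets (area_measure M)" "L \<in> sets (area_measure M)"
  shows "symm_diff_dist M K L \<le> 2 * a"
proof -
  let ?m = "measure (area_measure M)"
  have "?m (K \<union> L) = ?m ((K \<inter> L) \<union> ((K - L) \<union> (L - K)))" by (rule arg_cong[of _ _ ?m]) auto
  also have "\<dots> \<le> ?m (K \<inter> L) + ?m ((K - L) \<union> (L - K))" using sets by (intro measure_Un_le) auto
  also have "?m ((K - L) \<union> (L - K)) \<le> ?m (K - L) + ?m (L - K)" using sets by (intro measure_Un_le) auto
  also have "?m (K - L) \<le> a" using assms by (intro covered_within_measure_le)
  also have "?m (L - K) \<le> a" using assms by (intro covered_within_measure_le)
  finally show ?thesis by (simp add: symm_diff_dist_def area_def)
qed

text \<open>The common frame of the three planes. The map \<open>f\<close> is a chart in which both bodies become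
  convex; \<open>A\<close> is its Lipschitz constant at small scale, \<open>R\<close> bounds the region in use, and \<open>b\<close> says that
  area is at most quadratic in chart size. The covering is applied at every scale \<open>t\<close> above the
  Hausdorff distance rather than at the distance itself, so that nearby points exist without an
  appeal to compactness and equal bodies need no separate treatment.\<close>

lemma symm_diff_dist_bound:
  fixes f :: "'a \<Rightarrow> real \<times> real"
  assumes A: "0 < A" and b: "0 \<le> b" and R: "0 \<le> R" and ne: "K \<noteq> {}" "L \<noteq> {}"
    and sets: "K \<in> sets (area_measure M)" "L \<in> sets (area_measure M)"
    and inj: "inj_on f (K \<union> L)" and conv: "convex (f ` K)" "convex (f ` L)"
    and pos: "\<And>x y. x \<in> K \<union> L \<Longrightarrow> y \<in> K \<union> L \<Longrightarrow> 0 \<le> dist_fun M x y"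
    and bd: "\<And>x y. x \<in> K \<union> L \<Longrightarrow> y \<in> K \<union> L \<Longrightarrow> dist_fun M x y \<le> E"
    and bnd: "\<And>z. z \<in> K \<union> L \<Longrightarrow> \<bar>fst (f z)\<bar> \<le> R \<and> \<bar>snd (f z)\<bar> \<le> R"
    and lip: "\<And>x y. x \<in> K \<union> L \<Longrightarrow> y \<in> K \<union> L \<Longrightarrow> dist_fun M x y \<le> 1 \<Longrightarrow>
                chart_close f (A * dist_fun M x y) x y"
    and small: "\<And>S r. S \<subseteq> K \<union> L \<Longrightarrow> 0 < r \<Longrightarrow> \<forall>x\<in>S. \<forall>y\<in>S. chart_close f r x y \<Longrightarrow>
                  covered_within (area_measure M) (b * r\<^sup>2) S"
    and less: "hausdorff_dist M K L < 1"
  shows "symm_diff_dist M K L \<le> (72 * b * (2 * R + A) * A) * hausdorff_dist M K L"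
proof -
  let ?h = "hausdorff_dist M K L" and ?c = "72 * b * (2 * R + A) * A"
  have h0: "0 \<le> ?h" using ne pos bd by (intro hausdorff_dist_nonneg) auto
  have bound: "symm_diff_dist M K L \<le> ?c * t" if t: "?h < t" "t < 1" for t
  proof -
    have t0: "0 < t" using h0 t by simp
    have nearK: "\<exists>y\<in>L. chart_close f (A * t) y x" if x: "x \<in> K" for x
    proof -
      obtain y where y: "y \<in> L" "dist_fun M x y < t"
        using hausdorff_dist_near(1)[OF ne pos bd t(1) x] by blast
      then have "chart_close f (A * dist_fun M x y) x y" using lip[of x y] t x by simp
      then have "chart_close f (A * t) y x" 
        using y(2) A unfolding chart_close_def
        by (smt (verit) mult_left_mono)
      then show ?thesis using y by blast
    qed
    have nearL: "\<exists>x\<in>K. chart_close f (A * t) x y" if y: "y \<in> L" for y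
    proof -
      obtain x where x: "x \<in> K" "dist_fun M y x < t"
        using hausdorff_dist_near(2)[OF ne pos bd t(1) y] by blast
      then have "chart_close f (A * dist_fun M y x) y x" using lip[of y x] t y by simp
      then have "chart_close f (A * t) x y" 
        using x(2) A unfolding chart_close_def
        by (smt (verit) mult_left_mono)
      then show ?thesis using x by blast
    qed
    have small_L: "covered_within (area_measure M) (b * r\<^sup>2) S"
      if "S \<subseteq> L" "0 < r" "\<forall>x\<in>S. \<forall>y\<in>S. chart_close f r x y" for S r
      using small[of S r] that by blast
    have small_K: "covered_within (area_measure M) (b * r\<^sup>2) S"
      if "S \<subseteq> K" "0 < r" "\<forall>x\<in>S. \<forall>y\<in>S. chart_close f r x y" for S r
      using small[of S r] that by blast
    let ?a = "36 * b * (2 * R + A * t) * (A * t)"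
    have "covered_within (area_measure M) ?a (L - K)"
      using A t0 b R inj conv nearL bnd small_L
      by (intro difference_covered[of _ _ _ f]) auto
    moreover have "covered_within (area_measure M) ?a (K - L)"
      using A t0 b R inj conv nearK bnd small_K
      by (intro difference_covered[of _ _ _ f]) (auto simp: Un_commute)
    ultimately have "symm_diff_dist M K L \<le> 2 * ?a"
      using A t0 b R sets by (intro symm_diff_dist_le) auto
    also have "\<dots> = 72 * b * A * t * (2 * R + A * t)" by simp
    also have "\<dots> \<le> 72 * b * A * t * (2 * R + A)"
      using A t t0 b R by (intro mult_left_mono) auto
    finally show ?thesis by (simp add: mult_ac)
  qed
  define c where "c = ?c"
  have c: "0 \<le> c" using A b R by (simp add: c_def)
  show ?thesis
  proof (rule field_le_epsilon, fold c_def)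
    fix e :: real assume e: "0 < e"
    \<comment> \<open>The scale must stay below 1 and exceed the Hausdorff distance by little enough to lose only \<open>e\<close>.\<close>
    define t where "t = min ((?h + 1) / 2) (?h + e / (c + 1))"
    have "0 < e / (c + 1)" using c e by simp
    then have "?h < t" "t < 1" using less by (auto simp: t_def min_less_iff_disj)
    then have "symm_diff_dist M K L \<le> c * t" unfolding c_def by (rule bound)
    also have "\<dots> \<le> c * (?h + e / (c + 1))" using c by (intro mult_left_mono) (auto simp: t_def)
    also have "\<dots> = c * ?h + (c / (c + 1)) * e" by (simp add: algebra_simps)
    also have "(c / (c + 1)) * e \<le> 1 * e" using c e by (intro mult_right_mono) auto
    finally show "symm_diff_dist M K L \<le> c * ?h + e" by simp
  qed
qed

section \<open>The Euclidean plane\<close>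

lemma emeasure_lborel_cube:
  fixes s :: "'a::euclidean_space"
  assumes "0 \<le> r"
  shows "emeasure lborel (cbox (s - r *\<^sub>R One) (s + r *\<^sub>R One)) = ennreal ((2 * r) ^ DIM('a))"
proof -
  have "emeasure lborel (cbox (s - r *\<^sub>R One) (s + r *\<^sub>R One)) =
      ennreal (\<Prod>b\<in>(Basis::'a set). (s + r *\<^sub>R One - (s - r *\<^sub>R One)) \<bullet> b)"
    using assms by (intro emeasure_lborel_cbox) (simp add: inner_diff_left inner_add_left)
  also have "(\<Prod>b\<in>(Basis::'a set). (s + r *\<^sub>R One - (s - r *\<^sub>R One)) \<bullet> b) = (\<Prod>b\<in>(Basis::'a set). 2 * r)"
    by (intro prod.cong) (auto simp: inner_diff_left inner_add_left)
  finally show ?thesis by simp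
qed

lemma mem_cube:
  fixes s :: "'a::euclidean_space"
  shows "x \<in> cbox (s - r *\<^sub>R One) (s + r *\<^sub>R One) \<longleftrightarrow> (\<forall>b\<in>Basis. \<bar>x \<bullet> b - s \<bullet> b\<bar> \<le> r)"
  by (auto simp: mem_box inner_diff_left inner_add_left abs_le_iff algebra_simps) 

lemma euclidean_case:
  assumes K: "convex_body euclidean_plane K" and L: "convex_body euclidean_plane L"
    and diam: "diam euclidean_plane K \<le> D"
    and less: "hausdorff_dist euclidean_plane K L < 1"
  shows "symm_diff_dist euclidean_plane K L \<le> (288 * (2 * (D + 1) + 1)) * hausdorff_dist euclidean_plane K L"
proof -
  have K': "convex K" "compact K" "K \<noteq> {}" and L': "convex L" "compact L" "L \<noteq> {}"
    using K L by (auto simp: convex_body_euclidean_plane)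
  obtain x0 where x0: "x0 \<in> K" using K' by auto
  define f where "f x = (x $ 1 - x0 $ 1, x $ 2 - x0 $ 2)" for x :: "real^2"
  have bdd: "bounded (K \<union> L)" using K' L' by (simp add: compact_imp_bounded)
  have E: "dist_fun euclidean_plane x y \<le> diameter (K \<union> L)" if "x \<in> K \<union> L" "y \<in> K \<union> L" for x y
    using diameter_bounded_bound[OF bdd that] by (simp add: euclidean_plane_def)
  have D: "dist x y \<le> D" if "x \<in> K" "y \<in> K" for x y
    using dist_le_diam[OF that, of euclidean_plane "diameter (K \<union> L)"] E diam that
    by (force simp: euclidean_plane_def)
  have D0: "0 \<le> D" using D[OF x0 x0] by simp
  \<comment> \<open>Points of \<open>L\<close> are reached through points of \<open>K\<close> at distance less than 1.\<close>
  have near: "dist z x0 \<le> D + 1" if "z \<in> K \<union> L" for z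
  proof (cases "z \<in> K")
    case True then show ?thesis using D[OF True x0] by simp
  next
    case False
    then have "z \<in> L" using that by simp
    then obtain x where x: "x \<in> K" "dist z x < 1"
      using hausdorff_dist_near(2)[OF K'(3) L'(3) _ E less] by (auto simp: euclidean_plane_def)
    then show ?thesis using D[OF x(1) x0] dist_triangle[of z x0 x] by simp
  qed
  have comp: "\<bar>x $ i - y $ i\<bar> \<le> dist x y" for x y :: "real^2" and i
    by (metis component_le_norm_cart dist_norm vector_minus_component)
  have lin: "f ((1 - u) *\<^sub>R x + u *\<^sub>R y) = (1 - u) *\<^sub>R f x + u *\<^sub>R f y" for x y u
    by (simp add: f_def algebra_simps)
  have conv: "convex (f ` K)" "convex (f ` L)"
    using K' L' lin unfolding convex_alt by (smt (verit) imageE imageI)+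
  have "symm_diff_dist euclidean_plane K L \<le> (72 * 4 * (2 * (D + 1) + 1) * 1) * hausdorff_dist euclidean_plane K L"
  proof (rule symm_diff_dist_bound[where f = f and E = "diameter (K \<union> L)"])
    show "inj_on f (K \<union> L)" by (auto simp: inj_on_def f_def vec_eq_iff forall_2)
    show "K \<in> sets (area_measure euclidean_plane)" "L \<in> sets (area_measure euclidean_plane)"
      using K' L' by (auto simp: euclidean_plane_def borel_compact)
    show "\<bar>fst (f z)\<bar> \<le> D + 1 \<and> \<bar>snd (f z)\<bar> \<le> D + 1" if "z \<in> K \<union> L" for z
      using near[OF that] comp[of z 1 x0] comp[of z 2 x0] by (simp add: f_def)
    show "covered_within (area_measure euclidean_plane) (4 * r\<^sup>2) S"
      if S: "0 < r" "\<forall>x\<in>S. \<forall>y\<in>S. chart_close f r x y" for S r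
    proof (cases "S = {}")
      case True then show ?thesis by (simp add: covered_within_empty)
    next
      case False
      then obtain s where s: "s \<in> S" by auto
      have "S \<subseteq> cbox (s - r *\<^sub>R One) (s + r *\<^sub>R One)"
      proof
        fix x assume "x \<in> S"
        then have "chart_close f r x s" using S s by blast
        then have "\<bar>x $ i - s $ i\<bar> \<le> r" for i
          using exhaust_2[of i] by (auto simp: chart_close_def f_def)
        then show "x \<in> cbox (s - r *\<^sub>R One) (s + r *\<^sub>R One)"
          unfolding mem_cube by (auto simp: Basis_vec_def inner_axis)
      qed
      then show ?thesis
        unfolding covered_within_def euclidean_plane_def using S emeasure_lborel_cube[of r s]
        by (intro bexI[of _ "cbox (s - r *\<^sub>R One) (s + r *\<^sub>R One)"]) (auto simp: power_mult_distrib)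
    qed
  qed (use K' L' D0 E less comp conv in \<open>auto simp: chart_close_def euclidean_plane_def f_def\<close>)
  then show ?thesis by simp
qed

section \<open>The hyperbolic plane\<close>

text \<open>The intermediate value theorem for the two weights \<open>\<phi> t\<close> and \<open>\<phi> (l - t)\<close>. With \<open>\<phi>\<close> equal to
  \<open>sin\<close> or \<open>sinh\<close> these are, up to a common factor, the coefficients of the endpoints along a geodesic of
  length \<open>l\<close>, so every point of the straight segment in the chart is reached.\<close>

lemma crossing_point:
  fixes \<phi> :: "real \<Rightarrow> real"
  assumes "continuous_on UNIV \<phi>" "\<phi> 0 = 0" "0 \<le> \<phi> l" "0 \<le> a" "0 \<le> b" "0 \<le> l"
  obtains t where "0 \<le> t" "t \<le> l" "a * \<phi> t = b * \<phi> (l - t)"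
proof -
  have "continuous_on UNIV (\<lambda>t. l - t)" by (intro continuous_intros)
  then have \<phi>: "continuous_on UNIV (\<lambda>t. \<phi> (l - t))"
    using continuous_on_compose2[OF assms(1)] by blast
  have "\<exists>t\<ge>0. t \<le> l \<and> a * \<phi> t - b * \<phi> (l - t) = 0"
    by (rule IVT') (use assms in \<open>auto intro!: continuous_intros intro: continuous_on_subset[OF assms(1)] continuous_on_subset[OF \<phi>]\<close>)
  then show ?thesis using that by auto
qed

text \<open>The geodesics of the half-plane have equations \<open>x\<^sup>2 + y\<^sup>2 - 2 c x = const\<close> or \<open>x = const\<close>, which are
  linear in \<open>x\<close> and \<open>x\<^sup>2 + y\<^sup>2\<close>. This is the projective model with a parabola as its absolute.\<close>

definition hyp_chart :: "complex \<Rightarrow> real \<times> real" where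
  "hyp_chart z = (Re z, (Re z)\<^sup>2 + (Im z)\<^sup>2)"

lemma hyp_dist_eq:
  "dist_fun hyperbolic_plane z w = arcosh (1 + ((Re z - Re w)\<^sup>2 + (Im z - Im w)\<^sup>2) / (2 * Im z * Im w))"
  by (simp add: hyperbolic_plane_def cmod_power2)

lemma cosh_hyp_dist:
  assumes "0 < Im z" "0 < Im w"
  shows "cosh (dist_fun hyperbolic_plane z w) =
    1 + ((Re z - Re w)\<^sup>2 + (Im z - Im w)\<^sup>2) / (2 * Im z * Im w)" (is "_ = ?c")
    and "0 \<le> dist_fun hyperbolic_plane z w"
proof -
  have "1 \<le> ?c" using assms by simp
  then show "cosh (dist_fun hyperbolic_plane z w) = ?c" "0 \<le> dist_fun hyperbolic_plane z w"
    unfolding hyp_dist_eq by simp_all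
qed

text \<open>On the hyperboloid model \<open>(1 / y, x / y, (x\<^sup>2 + y\<^sup>2) / y)\<close>, with the form \<open>(p1 q3 + p3 q1) / 2 - p2 q2\<close>
  equal to \<open>cosh\<close> of the distance, the geodesic from \<open>P\<close> to \<open>Q\<close> is
  \<open>(sinh (l - t) P + sinh t Q) / sinh l\<close>. Dividing by the first coordinate gives the chart, so the
  geodesic runs along the straight segment.\<close>

lemma hyp_chart_geo_convex:
  assumes K: "geo_convex hyperbolic_plane K"
  shows "convex (hyp_chart ` K)"
  unfolding convex_def
proof (intro ballI allI impI)
  fix P Q and u v :: real
  assume "P \<in> hyp_chart ` K" "Q \<in> hyp_chart ` K" and uv: "0 \<le> u" "0 \<le> v" "u + v = 1"
  then obtain z w where z: "z \<in> K" "P = hyp_chart z" and w: "w \<in> K" "Q = hyp_chart w" by auto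
  show "u *\<^sub>R P + v *\<^sub>R Q \<in> hyp_chart ` K"
  proof (cases "z = w")
    case True
    then show ?thesis using z w uv by (metis imageI scaleR_left_distrib scaleR_one)
  next
    case False
    have pos: "0 < Im z" "0 < Im w"
      using K z w by (auto simp: geo_convex_def hyperbolic_plane_def)
    define x y x' y' where "x = Re z" and "y = Im z" and "x' = Re w" and "y' = Im w"
    have y: "0 < y" "0 < y'" using pos by (auto simp: y_def y'_def)
    define l where "l = dist_fun hyperbolic_plane z w"
    have cl: "cosh l = 1 + ((x - x')\<^sup>2 + (y - y')\<^sup>2) / (2 * y * y')" and l0: "0 \<le> l"
      using cosh_hyp_dist[OF pos] by (auto simp: l_def x_def y_def x'_def y'_def)
    have "l \<noteq> 0"
    proof
      assume "l = 0"
      then have "(x - x')\<^sup>2 + (y - y')\<^sup>2 = 0" using cl y by simp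
      then show False using False by (simp add: sum_power2_eq_zero_iff x_def y_def x'_def y'_def complex_eq_iff)
    qed
    then have l: "0 < l" using l0 by simp
    then have sl: "0 < sinh l" by simp
    define a b where "a t = sinh (l - t) / sinh l" and "b t = sinh t / sinh l" for t
    define p1 p2 p3 where "p1 t = a t / y + b t / y'" and "p2 t = a t * x / y + b t * x' / y'"
      and "p3 t = a t * (x\<^sup>2 + y\<^sup>2) / y + b t * (x'\<^sup>2 + y'\<^sup>2) / y'" for t
    define \<gamma> where "\<gamma> t = Complex (p2 t / p1 t) (1 / p1 t)" for t
    \<comment> \<open>The form of the points with parameters \<open>s\<close> and \<open>t\<close>, expanded by bilinearity.\<close>
    have ab: "a s * a t + b s * b t + (a s * b t + b s * a t) * cosh l = cosh (s - t)" for s t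
    proof -
      have "sinh (l - s) * sinh (l - t) + sinh s * sinh t + (sinh (l - s) * sinh t + sinh s * sinh (l - t)) * cosh l
          = sinh s * sinh t * (1 - cosh l ^ 2) + cosh s * cosh t * sinh l ^ 2"
        by (simp add: sinh_diff algebra_simps power2_eq_square)
      also have "\<dots> = cosh (s - t) * sinh l ^ 2"
        by (simp add: cosh_square_eq cosh_diff algebra_simps)
      finally have "(sinh (l - s) * sinh (l - t) + sinh s * sinh t + (sinh (l - s) * sinh t + sinh s * sinh (l - t)) * cosh l) / sinh l ^ 2 = cosh (s - t)"
        using sl by simp
      then show ?thesis
        by (simp add: a_def b_def add_divide_distrib power2_eq_square algebra_simps)
    qed
    have cl': "cosh l = (x\<^sup>2 + y\<^sup>2 + x'\<^sup>2 + y'\<^sup>2 - 2 * x * x') / (2 * y * y')"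
      unfolding cl using y by (simp add: field_simps power2_eq_square)
    have form: "(p1 s * p3 t + p3 s * p1 t) / 2 - p2 s * p2 t = cosh (s - t)" for s t
      unfolding ab[symmetric] p1_def p2_def p3_def cl' using y
      by (simp add: field_simps power2_eq_square)
    have p1: "0 < p1 t" if "0 \<le> t" "t \<le> l" for t
    proof (cases "t = 0")
      case True then show ?thesis using sl y by (simp add: p1_def a_def b_def)
    next
      case False
      then have "0 \<le> a t" "0 < b t" using that sl by (auto simp: a_def b_def)
      then show ?thesis using y unfolding p1_def by (simp add: add_nonneg_pos)
    qed
    \<comment> \<open>The point lies on the hyperboloid, hence comes from a point of the half-plane.\<close>
    have p13: "p2 t ^ 2 + 1 = p1 t * p3 t" for t
      using form[of t t] by (simp add: power2_eq_square algebra_simps)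
    have dist_\<gamma>: "dist_fun hyperbolic_plane (\<gamma> s) (\<gamma> t) = \<bar>s - t\<bar>"
      if st: "s \<in> {0..l}" "t \<in> {0..l}" for s t
    proof -
      have p: "0 < p1 s" "0 < p1 t" using p1 st by auto
      have "1 + ((Re (\<gamma> s) - Re (\<gamma> t))\<^sup>2 + (Im (\<gamma> s) - Im (\<gamma> t))\<^sup>2) / (2 * Im (\<gamma> s) * Im (\<gamma> t))
         = (p1 t * (p2 s ^ 2 + 1) / p1 s + p1 s * (p2 t ^ 2 + 1) / p1 t) / 2 - p2 s * p2 t"
        unfolding \<gamma>_def using p by (simp add: field_simps power2_eq_square)
      also have "\<dots> = (p1 s * p3 t + p3 s * p1 t) / 2 - p2 s * p2 t"
        unfolding p13 using p by (simp add: field_simps)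
      also have "\<dots> = cosh \<bar>s - t\<bar>" unfolding form by (simp add: abs_if flip: cosh_minus[of "s - t"])
      finally show ?thesis unfolding hyp_dist_eq by (metis arcosh_cosh_real abs_ge_zero)
    qed
    have "geodesic hyperbolic_plane z w \<gamma>"
      unfolding geodesic_def Let_def l_def[symmetric]
    proof (intro conjI)
      show "\<gamma> 0 = z" "\<gamma> l = w" using sl y
        by (auto simp: \<gamma>_def p1_def p2_def a_def b_def complex_eq_iff x_def y_def x'_def y'_def)
      show "\<gamma> ` {0..l} \<subseteq> points hyperbolic_plane"
        using p1 by (auto simp: hyperbolic_plane_def \<gamma>_def)
    qed (use dist_\<gamma> in blast)
    then have \<gamma>K: "\<gamma> ` {0..l} \<subseteq> K" using K z(1) w(1) unfolding geo_convex_def l_def by blast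
    obtain t where t: "0 \<le> t" "t \<le> l" "(u / y') * sinh t = (v / y) * sinh (l - t)"
      by (rule crossing_point[of sinh l "u / y'" "v / y"]) (use uv y l in \<open>auto intro!: continuous_intros\<close>)
    then have bal: "u * (b t / y') = v * (a t / y)"
    proof -
      have "u * (b t / y') = ((u / y') * sinh t) / sinh l" by (simp add: b_def)
      also have "\<dots> = v * (a t / y)" unfolding t(3) by (simp add: a_def)
      finally show ?thesis .
    qed
    \<comment> \<open>The normalized coefficients at the crossing point are the given weights \<open>u\<close> and \<open>v\<close>.\<close>
    have up: "u * p1 t = a t / y" and vp: "v * p1 t = b t / y'"
    proof -
      have "u * p1 t = (u + v) * (a t / y)" unfolding p1_def distrib_left distrib_right bal ..
      then show "u * p1 t = a t / y" unfolding uv(3) by simp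
      have "v * p1 t = (u + v) * (b t / y')" unfolding p1_def distrib_left distrib_right bal ..
      then show "v * p1 t = b t / y'" unfolding uv(3) by simp
    qed
    have P: "0 < p1 t" using p1 t by blast
    have "p2 t = (u * p1 t) * x + (v * p1 t) * x'" unfolding up vp p2_def by simp
    then have re: "p2 t / p1 t = u * x + v * x'" using P by (simp add: field_simps)
    have "p3 t = (u * p1 t) * (x\<^sup>2 + y\<^sup>2) + (v * p1 t) * (x'\<^sup>2 + y'\<^sup>2)" unfolding up vp p3_def by simp
    then have p3: "p3 t / p1 t = u * (x\<^sup>2 + y\<^sup>2) + v * (x'\<^sup>2 + y'\<^sup>2)" using P by (simp add: field_simps)
    have "(p2 t / p1 t)\<^sup>2 + (1 / p1 t)\<^sup>2 = (p2 t ^ 2 + 1) / p1 t ^ 2" by (simp add: power_divide add_divide_distrib)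
    also have "\<dots> = p3 t / p1 t" unfolding p13 using P by (simp add: power2_eq_square)
    finally have "hyp_chart (\<gamma> t) = u *\<^sub>R P + v *\<^sub>R Q"
      using re p3 by (simp add: hyp_chart_def \<gamma>_def z(2) w(2) x_def y_def x'_def y'_def)
    then show ?thesis using \<gamma>K t by (metis atLeastAtMost_iff image_eqI image_subset_iff)
  qed
qed

text \<open>The assumption says that \<open>(x, y)\<close> and \<open>(x', y')\<close> have hyperbolic distance at most
  \<open>arcosh c\<close>. Since it bounds \<open>y\<^sup>2 + y'\<^sup>2\<close> by \<open>2 c y y'\<close>, heights change by a factor of at most \<open>2 c\<close>.\<close>

lemma half_plane_comparison:
  fixes x x' y y' c :: real
  assumes y: "0 < y" "0 < y'" and c: "1 \<le> c"
    and le: "(x - x')\<^sup>2 + (y - y')\<^sup>2 \<le> 2 * (c - 1) * (y * y')"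
  shows "y \<le> 2 * c * y'" "y' \<le> 2 * c * y" "\<bar>x - x'\<bar> \<le> 2 * c * y'"
proof -
  have "y\<^sup>2 + y'\<^sup>2 \<le> 2 * c * (y * y') - (x - x')\<^sup>2" using le by (simp add: algebra_simps power2_eq_square)
  then have sq: "y\<^sup>2 + y'\<^sup>2 \<le> 2 * c * (y * y')" by (smt (verit) zero_le_power2)
  then have "y * y \<le> 2 * c * (y * y')" "y' * y' \<le> 2 * c * (y * y')"
    using zero_le_square[of y] zero_le_square[of y'] unfolding power2_eq_square by linarith+
  then have "y * y \<le> (2 * c * y') * y" "y' * y' \<le> (2 * c * y) * y'" by (simp_all add: mult_ac)
  then show yy: "y \<le> 2 * c * y'" and "y' \<le> 2 * c * y" using y by simp_all
  have "(x - x')\<^sup>2 \<le> 2 * c * (y * y')"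
    using le y c by (smt (verit) mult_pos_pos mult_right_mono zero_le_power2)
  also have "\<dots> \<le> 2 * c * ((2 * c * y') * y')" using yy y c by (intro mult_left_mono mult_right_mono) auto
  also have "\<dots> = (2 * c * y')\<^sup>2" by (simp add: power2_eq_square)
  finally show "\<bar>x - x'\<bar> \<le> 2 * c * y'" using y c abs_le_square_iff[of "x - x'" "2 * c * y'"] by simp
qed

lemma cosh_le_quadratic:
  fixes d :: real
  assumes "0 \<le> d" "d \<le> 1"
  shows "cosh d - 1 \<le> 2 * d\<^sup>2"
proof -
  have "exp (d / 2) \<le> 1 + d" using real_exp_bound_lemma[of "d / 2"] assms by simp
  moreover have "1 - d / 2 \<le> exp (- (d / 2))" using exp_ge_add_one_self[of "- (d / 2)"] by simp
  ultimately have "(exp (d / 2) - exp (- (d / 2))) / 2 \<le> ((1 + d) - (1 - d / 2)) / 2"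
    by (intro divide_right_mono diff_mono) auto
  also have "\<dots> \<le> d" using assms(1) by simp
  finally have "sinh (d / 2) \<le> d" by (simp add: sinh_field_def)
  then have "sinh (d / 2) ^ 2 \<le> d ^ 2" using assms by (intro power_mono) auto
  moreover have "cosh d = 1 + 2 * sinh (d / 2) ^ 2"
    using cosh_double[of "d / 2"] by (simp add: cosh_square_eq)
  ultimately show ?thesis by simp
qed

text \<open>The area density \<open>1 / y\<^sup>2\<close> is at most \<open>(M / y0)\<^sup>2\<close> at heights above \<open>y0 / M\<close>, and a set of coordinate
  size \<open>y0 r\<close> lies in a square of side \<open>2 y0 r\<close>; the scale \<open>y0\<close> cancels.\<close>

lemma hyperbolic_small_set_covered:
  assumes M: "1 \<le> M" and y0: "0 < y0" and r: "0 < r"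
    and S: "\<And>z. z \<in> S \<Longrightarrow> y0 / M \<le> Im z"
    and close: "\<And>z w. z \<in> S \<Longrightarrow> w \<in> S \<Longrightarrow> \<bar>Re z - Re w\<bar> \<le> y0 * r \<and> \<bar>Im z - Im w\<bar> \<le> y0 * r"
  shows "covered_within (area_measure hyperbolic_plane) (4 * M\<^sup>2 * r\<^sup>2) S"
proof (cases "S = {}")
  case True then show ?thesis by (simp add: covered_within_empty)
next
  case False
  then obtain s where s: "s \<in> S" by auto
  define Q where "Q = cbox (s - (y0 * r) *\<^sub>R One) (s + (y0 * r) *\<^sub>R One)"
  define B where "B = Q \<inter> {z. y0 / M \<le> Im z}"
  have B: "B \<in> sets borel" unfolding B_def Q_def by (intro sets.Int) (auto intro: borel_closed closed_halfspace_Im_ge)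
  have "S \<subseteq> B"
  proof
    fix z assume z: "z \<in> S"
    have "z \<in> Q" unfolding Q_def mem_cube using close[OF z s] by (simp add: Basis_complex_def inner_complex_def)
    then show "z \<in> B" using S[OF z] by (simp add: B_def)
  qed
  moreover have "emeasure (area_measure hyperbolic_plane) B \<le> ennreal (4 * M\<^sup>2 * r\<^sup>2)"
  proof -
    have [measurable]: "Q \<in> sets borel" "B \<in> sets borel" "{z. 0 < Im z} \<in> sets borel"
      using B by (auto simp: Q_def intro: borel_open open_halfspace_Im_gt)
    have "emeasure (area_measure hyperbolic_plane) B =
        (\<integral>\<^sup>+z. indicator {z. Im z > 0} z * ennreal (1 / (Im z)\<^sup>2) * indicator B z \<partial>lborel)"
      unfolding hyperbolic_plane_def surface.simps
      by (subst emeasure_density) auto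
    also have "\<dots> \<le> (\<integral>\<^sup>+z. ennreal (M\<^sup>2 / y0\<^sup>2) * indicator Q z \<partial>lborel)"
    proof (rule nn_integral_mono)
      fix z :: complex
      have "1 / (Im z)\<^sup>2 \<le> M\<^sup>2 / y0\<^sup>2" if "y0 / M \<le> Im z"
      proof -
        have "0 < y0 / M" using y0 M by simp
        then have "1 / (Im z)\<^sup>2 \<le> 1 / (y0 / M)\<^sup>2"
          using that by (intro divide_left_mono power_mono) (auto intro!: mult_pos_pos)
        then show ?thesis by (simp add: power_divide)
      qed
      then show "indicator {z. Im z > 0} z * ennreal (1 / (Im z)\<^sup>2) * indicator B z
          \<le> ennreal (M\<^sup>2 / y0\<^sup>2) * indicator Q z"
        by (auto simp: indicator_def B_def intro: ennreal_leI)
    qed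
    also have "\<dots> = ennreal (M\<^sup>2 / y0\<^sup>2) * ennreal ((2 * (y0 * r))\<^sup>2)"
      using y0 r by (subst nn_integral_cmult_indicator) (auto simp: Q_def emeasure_lborel_cube)
    also have "\<dots> = ennreal (4 * M\<^sup>2 * r\<^sup>2)"
      using y0 by (subst ennreal_mult[symmetric]) (auto simp: power_mult_distrib)
    finally show ?thesis .
  qed
  ultimately show ?thesis
    unfolding covered_within_def using B by (intro bexI[of _ B]) (auto simp: hyperbolic_plane_def)
qed

text \<open>The translation and dilation taking a point \<open>z0\<close> of \<open>K\<close> to \<open>\<i>\<close> are built into the coordinates
  \<open>X\<close>, \<open>Y\<close>. All of \<open>K\<close> is within \<open>D\<close> of \<open>z0\<close>, and \<open>L\<close> within \<open>1\<close> of \<open>K\<close>, so two uses of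
  \<open>half_plane_comparison\<close> put both bodies in the region \<open>1 / M \<le> Y \<le> M\<close>, \<open>\<bar>X\<bar> \<le> M\<close>, where the chart and the
  area have distortion bounded by powers of \<open>M\<close>.\<close>

lemma hyperbolic_case:
  assumes K: "convex_body hyperbolic_plane K" and L: "convex_body hyperbolic_plane L"
    and diam: "diam hyperbolic_plane K \<le> D"
    and less: "hausdorff_dist hyperbolic_plane K L < 1"
  defines "M \<equiv> 8 * cosh D * cosh 1"
  shows "symm_diff_dist hyperbolic_plane K L \<le>
    (72 * (36 * M ^ 6) * (2 * (2 * M\<^sup>2) + 8 * M\<^sup>2) * (8 * M\<^sup>2)) * hausdorff_dist hyperbolic_plane K L"
proof -
  let ?d = "dist_fun hyperbolic_plane"
  have K': "geo_convex hyperbolic_plane K" "compact K" "K \<noteq> {}"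
    and L': "geo_convex hyperbolic_plane L" "compact L" "L \<noteq> {}"
    using K L by (auto simp: convex_body_def interior_of_def)
  have Im: "0 < Im z" if "z \<in> K \<union> L" for z
    using K'(1) L'(1) that by (auto simp: geo_convex_def hyperbolic_plane_def)
  obtain E where E: "?d z w \<le> E" if "z \<in> K \<union> L" "w \<in> K \<union> L" for z w
  proof -
    have "compact ((K \<union> L) \<times> (K \<union> L))" using K' L' by (intro compact_Times compact_Un)
    moreover have "continuous_on ((K \<union> L) \<times> (K \<union> L)) (\<lambda>p. ?d (fst p) (snd p))"
      unfolding hyp_dist_eq
    proof (rule continuous_on_compose2[OF continuous_on_arcosh[OF order.refl]], intro continuous_intros ballI)
      fix p assume "p \<in> (K \<union> L) \<times> (K \<union> L)"
      then have pos: "0 < Im (fst p)" "0 < Im (snd p)" using Im by auto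
      then show "2 * Im (fst p) * Im (snd p) \<noteq> 0" by simp
    next
      show "(\<lambda>p. 1 + ((Re (fst p) - Re (snd p))\<^sup>2 + (Im (fst p) - Im (snd p))\<^sup>2) /
          (2 * Im (fst p) * Im (snd p))) ` ((K \<union> L) \<times> (K \<union> L)) \<subseteq> {1..}"
        using Im by (fastforce intro!: divide_nonneg_pos mult_pos_pos)
    qed
    ultimately have "bounded ((\<lambda>p. ?d (fst p) (snd p)) ` ((K \<union> L) \<times> (K \<union> L)))"
      by (intro compact_imp_bounded compact_continuous_image)
    then obtain E where "\<And>p. p \<in> (K \<union> L) \<times> (K \<union> L) \<Longrightarrow> \<bar>?d (fst p) (snd p)\<bar> \<le> E"
      unfolding bounded_iff by fastforce
    then show ?thesis by (intro that[of E]) force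
  qed
  obtain z0 where z0: "z0 \<in> K" using K' by auto
  define x0 y0 where "x0 = Re z0" and "y0 = Im z0"
  have y0: "0 < y0" using Im z0 by (simp add: y0_def)
  have pos: "0 \<le> ?d z w" if "z \<in> K \<union> L" "w \<in> K \<union> L" for z w
    using cosh_hyp_dist(2) Im that by blast
  have dD: "?d z w \<le> D" if "z \<in> K" "w \<in> K" for z w
    using dist_le_diam[OF that, of hyperbolic_plane E] E diam that by force
  have D0: "0 \<le> D" using dD[OF z0 z0] pos[of z0 z0] z0 by simp
  define X Y where "X z = (Re z - x0) / y0" and "Y z = Im z / y0" for z
  have Y: "0 < Y z" if "z \<in> K \<union> L" for z using Im[OF that] y0 by (simp add: Y_def)
  have cmp: "(X z - X w)\<^sup>2 + (Y z - Y w)\<^sup>2 \<le> 2 * (cosh t - 1) * (Y z * Y w)"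
    if zw: "z \<in> K \<union> L" "w \<in> K \<union> L" "?d z w \<le> t" for z w t
  proof -
    have p: "0 < Im z" "0 < Im w" using Im zw by auto
    have "((Re z - Re w)\<^sup>2 + (Im z - Im w)\<^sup>2) / (2 * Im z * Im w) = cosh (?d z w) - 1"
      using cosh_hyp_dist(1)[OF p] by simp
    also have "\<dots> \<le> cosh t - 1"
      using pos[OF zw(1,2)] zw(3) cosh_real_strict_mono[of "?d z w" t] by (cases "?d z w = t") auto
    finally have "(Re z - Re w)\<^sup>2 + (Im z - Im w)\<^sup>2 \<le> 2 * (cosh t - 1) * (Im z * Im w)"
      using p by (simp add: pos_divide_le_eq mult_ac)
    then have "((Re z - Re w)\<^sup>2 + (Im z - Im w)\<^sup>2) / y0\<^sup>2 \<le> 2 * (cosh t - 1) * (Im z * Im w) / y0\<^sup>2"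
      using y0 by (intro divide_right_mono) auto
    moreover have "X z - X w = (Re z - Re w) / y0" "Y z - Y w = (Im z - Im w) / y0"
      by (simp_all add: X_def Y_def diff_divide_distrib)
    ultimately show ?thesis
      by (simp add: Y_def power_divide add_divide_distrib) (simp add: power2_eq_square)
  qed
  have c: "1 \<le> cosh D" "1 \<le> cosh (1::real)" by (simp_all add: cosh_real_ge_1)
  have M8: "8 * cosh D \<le> M" unfolding M_def using mult_left_mono[OF c(2), of "8 * cosh D"] c by simp
  have M: "1 \<le> M" using M8 c by simp
  have YK: "1 / (2 * cosh D) \<le> Y z" "Y z \<le> 2 * cosh D" "\<bar>X z\<bar> \<le> 2 * cosh D" if z: "z \<in> K" for z
  proof -
    have "X z0 = 0" "Y z0 = 1" using y0 by (simp_all add: X_def Y_def x0_def y0_def)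
    then have *: "(X z - 0)\<^sup>2 + (Y z - 1)\<^sup>2 \<le> 2 * (cosh D - 1) * (Y z * 1)"
      using cmp[of z z0 D] z z0 dD[OF z z0] by simp
    show "Y z \<le> 2 * cosh D" "\<bar>X z\<bar> \<le> 2 * cosh D" "1 / (2 * cosh D) \<le> Y z"
      using half_plane_comparison[OF _ _ c(1) *] Y[of z] z c by (auto simp: field_simps)
  qed
  have region: "1 / M \<le> Y z \<and> Y z \<le> M \<and> \<bar>X z\<bar> \<le> M" if z: "z \<in> K \<union> L" for z
  proof (cases "z \<in> K")
    case True
    have "1 / M \<le> 1 / (2 * cosh D)" using M8 c by (intro divide_left_mono) auto
    then show ?thesis using YK[OF True] M8 c by auto
  next
    case False
    then have zL: "z \<in> L" using z by simp
    obtain w where w: "w \<in> K" "?d z w < 1"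
      using hausdorff_dist_near(2)[OF K'(3) L'(3) pos E less zL] by blast
    have *: "(X z - X w)\<^sup>2 + (Y z - Y w)\<^sup>2 \<le> 2 * (cosh 1 - 1) * (Y z * Y w)"
      using cmp[of z w 1] z w by simp
    have yz: "0 < Y z" "0 < Y w" using Y z w by auto
    note cp = half_plane_comparison[OF yz c(2) *]
    have "Y z \<le> 2 * cosh 1 * (2 * cosh D)" using cp(1) YK(2)[OF w(1)] c
      by (smt (verit) mult_left_mono)
    also have "\<dots> \<le> M" unfolding M_def using c by simp
    finally have 1: "Y z \<le> M" .
    have "1 / (2 * cosh D) \<le> 2 * cosh 1 * Y z" using cp(2) YK(1)[OF w(1)] by simp
    then have "1 \<le> 4 * cosh D * cosh 1 * Y z" using c by (simp add: field_simps)
    also have "\<dots> \<le> M * Y z" unfolding M_def using c yz by simp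
    finally have 2: "1 / M \<le> Y z" using M by (simp add: field_simps)
    have "2 * cosh 1 * Y w \<le> 2 * cosh 1 * (2 * cosh D)" using YK(2)[OF w(1)] c by (intro mult_left_mono) auto
    then have "\<bar>X z\<bar> \<le> 2 * cosh D + 2 * cosh 1 * (2 * cosh D)" using cp(3) YK(3)[OF w(1)] by linarith
    also have "\<dots> \<le> 4 * cosh D * cosh 1 + 4 * cosh D * cosh 1"
      using c mult_left_mono[OF c(2), of "2 * cosh D"] by (intro add_mono) auto
    also have "\<dots> = M" by (simp add: M_def)
    finally show ?thesis using 1 2 by simp
  qed
  define f where "f z = (X z, (X z)\<^sup>2 + (Y z)\<^sup>2)" for z
  have MM: "M \<le> M\<^sup>2" using M by (simp add: power2_eq_square)
  \<comment> \<open>The normalized chart is an affine map after \<open>hyp_chart\<close>, so it keeps the convexity of images.\<close>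
  have lin: "f z = (\<lambda>p. ((fst p - x0) / y0, (snd p - 2 * x0 * fst p + x0\<^sup>2) / y0\<^sup>2)) (hyp_chart z)" for z
    by (simp add: f_def X_def Y_def hyp_chart_def power_divide power2_diff add_divide_distrib diff_divide_distrib mult_ac)
      (simp add: power2_eq_square)
  have conv: "convex (f ` A)" if "geo_convex hyperbolic_plane A" for A
  proof -
    define g where "g = (\<lambda>p. ((fst p - x0) / y0, (snd p - 2 * x0 * fst p + x0\<^sup>2) / y0\<^sup>2))"
    have "g ((1 - u) *\<^sub>R p + u *\<^sub>R q) = (1 - u) *\<^sub>R g p + u *\<^sub>R g q" for u p q
      using y0 by (simp add: g_def field_simps)
    then have "convex (g ` hyp_chart ` A)"
      using hyp_chart_geo_convex[OF that] unfolding convex_alt by (smt (verit) imageE imageI)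
    moreover have "f ` A = g ` hyp_chart ` A" unfolding image_image by (simp add: lin g_def)
    ultimately show ?thesis by simp
  qed
  show ?thesis
  proof (rule symm_diff_dist_bound[where f = f and E = E])
    show "inj_on f (K \<union> L)"
    proof (rule inj_onI)
      fix z w assume zw: "z \<in> K \<union> L" "w \<in> K \<union> L" "f z = f w"
      then have "X z = X w" "Y z = Y w" using Y[of z] Y[of w] 
        by (auto simp: f_def power2_eq_iff_nonneg)
      then show "z = w" using y0 by (simp add: X_def Y_def complex_eq_iff)
    qed
    show "K \<in> sets (area_measure hyperbolic_plane)" "L \<in> sets (area_measure hyperbolic_plane)"
      using K' L' by (auto simp: hyperbolic_plane_def borel_compact)
    show "\<bar>fst (f z)\<bar> \<le> 2 * M\<^sup>2 \<and> \<bar>snd (f z)\<bar> \<le> 2 * M\<^sup>2" if "z \<in> K \<union> L" for z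
    proof -
      have "(X z)\<^sup>2 \<le> M\<^sup>2" "(Y z)\<^sup>2 \<le> M\<^sup>2" "\<bar>X z\<bar> \<le> M"
        using region[OF that] Y[OF that] by (auto simp: abs_le_square_iff[symmetric])
      then show ?thesis using MM by (simp add: f_def)
    qed
    show "chart_close f (8 * M\<^sup>2 * ?d z w) z w" if zw: "z \<in> K \<union> L" "w \<in> K \<union> L" "?d z w \<le> 1" for z w
    proof -
      let ?t = "?d z w"
      have rz: "Y z \<le> M" "\<bar>X z\<bar> \<le> M" "0 < Y z" and rw: "Y w \<le> M" "\<bar>X w\<bar> \<le> M" "0 < Y w"
        using region Y zw by auto
      have t: "0 \<le> ?t" using pos zw by blast
      have "(X z - X w)\<^sup>2 + (Y z - Y w)\<^sup>2 \<le> 2 * (cosh ?t - 1) * (Y z * Y w)" using cmp zw by blast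
      also have "\<dots> \<le> 2 * (2 * ?t\<^sup>2) * (M * M)"
        using cosh_le_quadratic[OF t zw(3)] rz rw M cosh_real_ge_1[of ?t] by (intro mult_mono) auto
      also have "\<dots> = (2 * ?t * M)\<^sup>2" by (simp add: power2_eq_square)
      finally have "(X z - X w)\<^sup>2 \<le> (2 * ?t * M)\<^sup>2" "(Y z - Y w)\<^sup>2 \<le> (2 * ?t * M)\<^sup>2"
        by (smt (verit) zero_le_power2)+
      then have dX: "\<bar>X z - X w\<bar> \<le> 2 * ?t * M" and dY: "\<bar>Y z - Y w\<bar> \<le> 2 * ?t * M"
        using t M by (auto simp: abs_le_square_iff[symmetric])
      have "2 * ?t * M \<le> 8 * M\<^sup>2 * ?t" 
        using mult_right_mono[OF MM t] mult_nonneg_nonneg[OF zero_le_power2[of M] t] by (simp add: mult_ac)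
      then have 1: "\<bar>X z - X w\<bar> \<le> 8 * M\<^sup>2 * ?t" using dX by linarith
      have "(X z)\<^sup>2 + (Y z)\<^sup>2 - ((X w)\<^sup>2 + (Y w)\<^sup>2) = (X z + X w) * (X z - X w) + (Y z + Y w) * (Y z - Y w)"
        by (simp add: power2_eq_square algebra_simps)
      also have "\<bar>\<dots>\<bar> \<le> \<bar>X z + X w\<bar> * \<bar>X z - X w\<bar> + \<bar>Y z + Y w\<bar> * \<bar>Y z - Y w\<bar>"
        by (metis abs_mult abs_triangle_ineq)
      also have "\<dots> \<le> (2 * M) * (2 * ?t * M) + (2 * M) * (2 * ?t * M)"
        using rz rw dX dY M by (intro add_mono mult_mono) auto
      also have "\<dots> = 8 * M\<^sup>2 * ?t" by (simp add: power2_eq_square)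
      finally show ?thesis using 1 by (simp add: chart_close_def f_def)
    qed
    show "covered_within (area_measure hyperbolic_plane) (36 * M ^ 6 * r\<^sup>2) S"
      if S: "S \<subseteq> K \<union> L" "0 < r" "\<forall>x\<in>S. \<forall>y\<in>S. chart_close f r x y" for S r
    proof -
      have "covered_within (area_measure hyperbolic_plane) (4 * M\<^sup>2 * (3 * M\<^sup>2 * r)\<^sup>2) S"
      proof (rule hyperbolic_small_set_covered[OF M y0])
        show "0 < 3 * M\<^sup>2 * r" using M S by simp
        show "y0 / M \<le> Im z" if "z \<in> S" for z
          using region[of z] S that y0 M by (auto simp: Y_def field_simps)
        fix z w assume "z \<in> S" "w \<in> S"
        then have zw: "z \<in> K \<union> L" "w \<in> K \<union> L" "chart_close f r z w" using S by auto
        have rz: "1 / M \<le> Y z" "\<bar>X z\<bar> \<le> M" "0 < Y z" and rw: "\<bar>X w\<bar> \<le> M" "0 < Y w"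
          using region Y zw by auto
        have dX: "\<bar>X z - X w\<bar> \<le> r" and df: "\<bar>(X z)\<^sup>2 + (Y z)\<^sup>2 - ((X w)\<^sup>2 + (Y w)\<^sup>2)\<bar> \<le> r"
          using zw(3) by (auto simp: chart_close_def f_def)
        have "\<bar>X z + X w\<bar> * \<bar>X z - X w\<bar> \<le> (2 * M) * r" using rz rw dX M by (intro mult_mono) auto
        then have dXX: "\<bar>(X z)\<^sup>2 - (X w)\<^sup>2\<bar> \<le> 2 * M * r"
          by (simp add: power2_eq_square square_diff_square_factored abs_mult mult_ac)
        have "\<bar>Y z - Y w\<bar> * (1 / M) \<le> \<bar>Y z - Y w\<bar> * (Y z + Y w)"
          using rz rw by (intro mult_left_mono) auto
        also have "\<dots> = \<bar>(Y z)\<^sup>2 - (Y w)\<^sup>2\<bar>"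
          using rz rw by (simp add: power2_eq_square square_diff_square_factored abs_mult)
        also have "\<dots> \<le> r + 2 * M * r" using df dXX by linarith
        also have "\<dots> \<le> 3 * M * r" using M S(2) by (simp add: field_simps)
        finally have "\<bar>Y z - Y w\<bar> \<le> 3 * M\<^sup>2 * r" using M by (simp add: field_simps power2_eq_square)
        moreover have "\<bar>X z - X w\<bar> \<le> 3 * M\<^sup>2 * r"
        proof -
          have "r * 1 \<le> r * (3 * M\<^sup>2)" using M MM S(2) by (intro mult_left_mono) auto
          then show ?thesis using dX by (simp add: mult_ac)
        qed
        moreover have "Re z - Re w = y0 * (X z - X w)" "Im z - Im w = y0 * (Y z - Y w)"
          using y0 by (simp_all add: X_def Y_def field_simps)
        ultimately show "\<bar>Re z - Re w\<bar> \<le> y0 * (3 * M\<^sup>2 * r) \<and> \<bar>Im z - Im w\<bar> \<le> y0 * (3 * M\<^sup>2 * r)"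
          using y0 by (simp add: abs_mult)
      qed
      moreover have "4 * M\<^sup>2 * (3 * M\<^sup>2 * r)\<^sup>2 = 36 * M ^ 6 * r\<^sup>2"
        by (simp add: power_mult_distrib flip: power_mult power_add)
      ultimately show ?thesis by simp
    qed
  qed (use K' L' M E pos less conv in auto)
qed

section \<open>The sphere\<close>

text \<open>A linear lower bound with any positive constant would do; \<open>1 / 4\<close> comes from applying the mean value theorem
  on \<open>[0, v / 2]\<close>, where \<open>cos\<close> is at least \<open>1 / 2\<close>, and doubling the angle.\<close>

lemma sin_ge_quarter:
  fixes v :: real
  assumes "0 \<le> v" "v \<le> pi / 2"
  shows "v / 4 \<le> sin v"
proof (cases "v = 0")
  case False
  then have v: "0 < v / 2" "v / 2 \<le> pi / 4" using assms by auto
  have cos_half: "1 / 2 \<le> cos z" if "0 \<le> z" "z \<le> v / 2" for z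
  proof -
    have "cos (pi / 3) \<le> cos z" using that v by (subst cos_mono_le_eq) auto
    then show ?thesis by (simp add: cos_60)
  qed
  obtain z where z: "0 < z" "z < v / 2" "sin (v / 2) - sin 0 = (v / 2 - 0) * cos z"
    using MVT2[of 0 "v / 2" sin cos] v by (auto intro: DERIV_sin)
  have "(v / 2) * (1 / 2) \<le> (v / 2) * cos z" using cos_half[of z] z v by (intro mult_left_mono) auto
  moreover have "sin (v / 2) = (v / 2) * cos z" using z(3) by simp
  ultimately have "v / 4 \<le> sin (v / 2)" by linarith
  moreover have "sin (v / 2) * (1 / 2) \<le> sin (v / 2) * cos (v / 2)"
    using cos_half[of "v / 2"] v calculation by (intro mult_left_mono) auto
  moreover have "sin v = 2 * (sin (v / 2) * cos (v / 2))" using sin_double[of "v / 2"] by simp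
  ultimately show ?thesis by simp
qed simp

lemma dist_sph_coords:
  "(dist (sph_coords (\<theta>, \<phi>)) (sph_coords (\<theta>', \<phi>')))\<^sup>2 =
    2 - 2 * (sin \<theta> * sin \<theta>' * cos (\<phi> - \<phi>') + cos \<theta> * cos \<theta>')"
proof -
  have "(dist (sph_coords (\<theta>, \<phi>)) (sph_coords (\<theta>', \<phi>')))\<^sup>2 =
    (sin \<theta> * cos \<phi> - sin \<theta>' * cos \<phi>')\<^sup>2 + (sin \<theta> * sin \<phi> - sin \<theta>' * sin \<phi>')\<^sup>2 + (cos \<theta> - cos \<theta>')\<^sup>2"
    by (simp add: dist_vec_def L2_set_def sum_3 sph_coords_def dist_real_def add_nonneg_nonneg)
  also have "\<dots> = (sin \<theta>)\<^sup>2 * ((sin \<phi>)\<^sup>2 + (cos \<phi>)\<^sup>2) + (cos \<theta>)\<^sup>2 + ((sin \<theta>')\<^sup>2 * ((sin \<phi>')\<^sup>2 + (cos \<phi>')\<^sup>2) + (cos \<theta>')\<^sup>2)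
      - 2 * (sin \<theta> * sin \<theta>' * cos (\<phi> - \<phi>') + cos \<theta> * cos \<theta>')"
    unfolding cos_diff by algebra
  finally show ?thesis by simp
qed

text \<open>A ball of radius \<open>\<rho>\<close> occupies a range of length \<open>O(\<rho>)\<close> in the polar angle. On the parallel at polar angle
  \<open>\<theta>\<close>, which is a circle of radius \<open>sin \<theta>\<close>, it occupies azimuths of total length \<open>O(\<rho> / sin \<theta>)\<close>, and
  the factor \<open>sin \<theta>\<close> of the area element compensates for the denominator, uniformly up to the poles.\<close>

lemma spherical_small_set_covered:
  assumes \<rho>: "0 < \<rho>" and S: "\<And>x y. x \<in> S \<Longrightarrow> y \<in> S \<Longrightarrow> dist x y \<le> \<rho>"
  shows "covered_within (area_measure unit_sphere) (768 * \<rho>\<^sup>2) S"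
proof (cases "S = {}")
  case True then show ?thesis by (simp add: covered_within_empty)
next
  case False
  then obtain s where s: "s \<in> S" by auto
  define P where "P = ({0..pi} \<times> {0..<2 * pi}) \<inter> sph_coords -` cball s \<rho>"
  have [measurable]: "({0..pi} \<times> {0..<2 * pi}) \<in> sets (borel :: (real \<times> real) measure)"
    by (intro borel_Times) auto
  have [measurable]: "P \<in> sets borel"
    unfolding P_def using measurable_sets[OF sph_coords_measurable, of "cball s \<rho>"] by auto
  have dP: "dist (sph_coords p) (sph_coords q) \<le> 2 * \<rho>" if "p \<in> P" "q \<in> P" for p q
  proof -
    have "dist s (sph_coords p) \<le> \<rho>" "dist s (sph_coords q) \<le> \<rho>" using that by (auto simp: P_def)
    then show ?thesis using dist_triangle3[of "sph_coords p" "sph_coords q" s] by linarith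
  qed
  have polar: "\<bar>\<theta> - \<theta>'\<bar> \<le> 8 * \<rho>" if p: "(\<theta>, \<phi>) \<in> P" "(\<theta>', \<phi>') \<in> P" for \<theta> \<phi> \<theta>' \<phi>'
  proof -
    define v where "v = \<bar>\<theta> - \<theta>'\<bar> / 2"
    have range: "0 \<le> \<theta>" "\<theta> \<le> pi" "0 \<le> \<theta>'" "\<theta>' \<le> pi" using p by (auto simp: P_def)
    then have v: "0 \<le> v" "v \<le> pi / 2" by (auto simp: v_def abs_if)
    have "sin \<theta> * sin \<theta>' * cos (\<phi> - \<phi>') \<le> sin \<theta> * sin \<theta>' * 1"
      using range by (intro mult_left_mono) (auto intro!: mult_nonneg_nonneg sin_ge_zero)
    then have "2 - 2 * cos (\<theta> - \<theta>') \<le> (dist (sph_coords (\<theta>, \<phi>)) (sph_coords (\<theta>', \<phi>')))\<^sup>2"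
      unfolding dist_sph_coords by (simp add: cos_diff)
    also have "\<dots> \<le> (2 * \<rho>)\<^sup>2" using dP[OF p] by (intro power_mono) auto
    also have "cos (\<theta> - \<theta>') = cos (2 * v)" by (simp add: v_def)
    finally have "(2 * sin v)\<^sup>2 \<le> (2 * \<rho>)\<^sup>2" by (simp add: cos_double_sin power_mult_distrib)
    then have "sin v \<le> \<rho>" using \<rho> by (simp add: power2_le_iff_abs_le)
    then show ?thesis using sin_ge_quarter[OF v] by (simp add: v_def)
  qed
  \<comment> \<open>Azimuths are compared modulo \<open>2 * pi\<close>, whence the second alternative.\<close>
  have azimuth: "sin \<theta> * \<bar>\<phi> - \<phi>'\<bar> \<le> 8 * \<rho> \<or> sin \<theta> * (2 * pi - \<bar>\<phi> - \<phi>'\<bar>) \<le> 8 * \<rho>"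
    if p: "(\<theta>, \<phi>) \<in> P" "(\<theta>, \<phi>') \<in> P" for \<theta> \<phi> \<phi>'
  proof -
    define v where "v = \<bar>\<phi> - \<phi>'\<bar> / 2"
    have "0 \<le> \<phi>" "\<phi> < 2 * pi" "0 \<le> \<phi>'" "\<phi>' < 2 * pi" using p by (auto simp: P_def)
    then have v: "0 \<le> v" "v \<le> pi" by (auto simp: v_def abs_if)
    have s0: "0 \<le> sin \<theta>" using p by (auto simp: P_def intro: sin_ge_zero)
    have "cos (\<phi> - \<phi>') = 1 - 2 * (sin v)\<^sup>2" using cos_double_sin[of v] by (simp add: v_def)
    then have "(2 * (sin \<theta> * sin v))\<^sup>2 = 2 - 2 * (sin \<theta> * sin \<theta> * cos (\<phi> - \<phi>') + cos \<theta> * cos \<theta>)"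
      using sin_cos_squared_add[of \<theta>] by algebra
    also have "\<dots> \<le> (2 * \<rho>)\<^sup>2" unfolding dist_sph_coords[symmetric] using dP[OF p] by (intro power_mono) auto
    finally have "\<bar>2 * (sin \<theta> * sin v)\<bar> \<le> 2 * \<rho>" using \<rho> by (simp add: power2_le_iff_abs_le)
    then have le: "sin \<theta> * sin v \<le> \<rho>" by linarith
    show ?thesis
    proof (cases "v \<le> pi / 2")
      case True
      have "sin \<theta> * (v / 4) \<le> sin \<theta> * sin v" using sin_ge_quarter[OF v(1) True] s0 by (intro mult_left_mono)
      then show ?thesis using le by (simp add: v_def)
    next
      case False
      have "(pi - v) / 4 \<le> sin v" using sin_ge_quarter[of "pi - v"] v False by simp
      then have "sin \<theta> * ((pi - v) / 4) \<le> sin \<theta> * sin v" using s0 by (intro mult_left_mono)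
      then have "sin \<theta> * (pi - v) \<le> 4 * \<rho>" using le by simp
      then show ?thesis by (simp add: v_def algebra_simps)
    qed
  qed
  have sin_fst: "(\<lambda>p::real \<times> real. ennreal (sin (fst p))) \<in> borel_measurable borel"
    by (rule measurable_compose[OF _ measurable_ennreal], rule borel_measurable_continuous_onI)
       (intro continuous_intros)
  define g where "g p = indicator P p * ennreal (sin (fst p))" for p :: "real \<times> real"
  have g[measurable]: "g \<in> borel_measurable borel"
    unfolding g_def by (intro borel_measurable_times_ennreal borel_measurable_indicator sin_fst) auto
  obtain \<theta>0 where \<theta>0: "\<And>\<theta> \<phi>. (\<theta>, \<phi>) \<in> P \<Longrightarrow> \<bar>\<theta> - \<theta>0\<bar> \<le> 8 * \<rho>"
    using polar by (metis ex_in_conv old.prod.exhaust)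
  have inner: "(\<integral>\<^sup>+\<phi>. g (\<theta>, \<phi>) \<partial>lborel) \<le> ennreal (48 * \<rho>) * indicator {\<theta>0 - 8 * \<rho>..\<theta>0 + 8 * \<rho>} \<theta>" for \<theta>
  proof (cases "\<exists>\<phi>. (\<theta>, \<phi>) \<in> P \<and> sin \<theta> \<noteq> 0")
    case False
    then have "g (\<theta>, \<phi>) = 0" for \<phi> by (auto simp: g_def indicator_def)
    then show ?thesis by simp
  next
    case True
    then obtain \<phi>1 where \<phi>1: "(\<theta>, \<phi>1) \<in> P" "sin \<theta> \<noteq> 0" by auto
    have "0 \<le> sin \<theta>" using \<phi>1 by (auto simp: P_def intro: sin_ge_zero)
    then have s0: "0 < sin \<theta>" using \<phi>1 by simp
    define \<delta> where "\<delta> = 8 * \<rho> / sin \<theta>"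
    define J where "J c = {c - \<delta>..c + \<delta>}" for c
    have \<delta>: "0 < \<delta>" using \<rho> s0 by (simp add: \<delta>_def)
    have J: "emeasure lborel (J c) = ennreal (2 * \<delta>)" for c
      using \<delta> by (simp add: J_def)
    \<comment> \<open>Three intervals, because the coordinate \<open>\<phi>\<close> is cut at \<open>0\<close> and \<open>2 * pi\<close>.\<close>
    have JJ: "emeasure lborel (J \<phi>1 \<union> (J (\<phi>1 - 2 * pi) \<union> J (\<phi>1 + 2 * pi))) \<le> ennreal (6 * \<delta>)"
    proof -
      have "emeasure lborel (J \<phi>1 \<union> (J (\<phi>1 - 2 * pi) \<union> J (\<phi>1 + 2 * pi)))
          \<le> emeasure lborel (J \<phi>1) + emeasure lborel (J (\<phi>1 - 2 * pi) \<union> J (\<phi>1 + 2 * pi))"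
        by (intro emeasure_subadditive) (auto simp: J_def)
      also have "\<dots> \<le> emeasure lborel (J \<phi>1) + (emeasure lborel (J (\<phi>1 - 2 * pi)) + emeasure lborel (J (\<phi>1 + 2 * pi)))"
        by (intro add_left_mono emeasure_subadditive) (auto simp: J_def)
      also have "\<dots> = ennreal (6 * \<delta>)" unfolding J using \<delta> by (simp flip: ennreal_plus)
      finally show ?thesis .
    qed
    have "(\<integral>\<^sup>+\<phi>. g (\<theta>, \<phi>) \<partial>lborel) \<le>
      (\<integral>\<^sup>+\<phi>. ennreal (sin \<theta>) * indicator (J \<phi>1 \<union> (J (\<phi>1 - 2 * pi) \<union> J (\<phi>1 + 2 * pi))) \<phi> \<partial>lborel)"
    proof (rule nn_integral_mono)
      fix \<phi>
      have "\<phi> \<in> J \<phi>1 \<union> (J (\<phi>1 - 2 * pi) \<union> J (\<phi>1 + 2 * pi))" if "(\<theta>, \<phi>) \<in> P"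
      proof -
        have "\<bar>\<phi> - \<phi>1\<bar> \<le> \<delta> \<or> 2 * pi - \<bar>\<phi> - \<phi>1\<bar> \<le> \<delta>"
          using azimuth[OF that \<phi>1(1)] s0 by (simp add: \<delta>_def pos_le_divide_eq mult.commute)
        then show ?thesis unfolding J_def Un_iff atLeastAtMost_iff
          using that \<phi>1(1) by (auto simp: P_def abs_if split: if_splits)
      qed
      then show "g (\<theta>, \<phi>) \<le> ennreal (sin \<theta>) * indicator (J \<phi>1 \<union> (J (\<phi>1 - 2 * pi) \<union> J (\<phi>1 + 2 * pi))) \<phi>"
        by (auto simp: g_def indicator_def)
    qed
    also have "\<dots> = ennreal (sin \<theta>) * emeasure lborel (J \<phi>1 \<union> (J (\<phi>1 - 2 * pi) \<union> J (\<phi>1 + 2 * pi)))"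
      by (intro nn_integral_cmult_indicator) (auto simp: J_def)
    also have "\<dots> \<le> ennreal (sin \<theta>) * ennreal (6 * \<delta>)" using JJ by (intro mult_left_mono) auto
    also have "\<dots> = ennreal (48 * \<rho>)" using s0 \<delta> by (subst ennreal_mult[symmetric]) (auto simp: \<delta>_def)
    also have "\<dots> = ennreal (48 * \<rho>) * indicator {\<theta>0 - 8 * \<rho>..\<theta>0 + 8 * \<rho>} \<theta>"
      using \<theta>0[OF \<phi>1(1)] by (auto simp: abs_le_iff indicator_def)
    finally show ?thesis .
  qed
  have "emeasure (area_measure unit_sphere) (cball s \<rho>) =
      (\<integral>\<^sup>+p. indicator ({0..pi} \<times> {0..<2 * pi}) p * ennreal (sin (fst p)) * indicator (sph_coords -` cball s \<rho>) p \<partial>lborel)"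
  proof -
    have "sph_coords -` cball s \<rho> \<in> sets borel"
      using measurable_sets[OF sph_coords_measurable, of "cball s \<rho>"] by auto
    then have A: "sph_coords -` cball s \<rho> \<in> sets lborel" by simp
    have "(\<lambda>p::real \<times> real. indicator ({0..pi} \<times> {0..<2 * pi}) p * ennreal (sin (fst p))) \<in> borel_measurable borel"
      by (rule borel_measurable_times_ennreal[OF borel_measurable_indicator sin_fst]) measurable
    then have "(\<lambda>p::real \<times> real. indicator ({0..pi} \<times> {0..<2 * pi}) p * ennreal (sin (fst p))) \<in> borel_measurable lborel"
      by simp
    note density = emeasure_density[OF this A]
    show ?thesis
      unfolding unit_sphere_def surface.simps
      by (subst emeasure_distr) (simp_all add: density)
  qed
  also have "\<dots> = (\<integral>\<^sup>+p. g p \<partial>lborel)"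
    by (intro nn_integral_cong) (auto simp: g_def P_def indicator_def)
  also have "\<dots> = (\<integral>\<^sup>+\<theta>. \<integral>\<^sup>+\<phi>. g (\<theta>, \<phi>) \<partial>lborel \<partial>lborel)"
    using g by (subst lborel.nn_integral_fst) (simp_all add: lborel_prod)
  also have "\<dots> \<le> (\<integral>\<^sup>+\<theta>. ennreal (48 * \<rho>) * indicator {\<theta>0 - 8 * \<rho>..\<theta>0 + 8 * \<rho>} \<theta> \<partial>lborel)"
    by (intro nn_integral_mono inner)
  also have "\<dots> = ennreal (48 * \<rho>) * ennreal (16 * \<rho>)"
    using \<rho> by (subst nn_integral_cmult_indicator) auto
  also have "\<dots> = ennreal (768 * \<rho>\<^sup>2)"
    using \<rho> by (subst ennreal_mult[symmetric]) (auto simp: power2_eq_square)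
  finally show ?thesis
    unfolding covered_within_def using S[OF s]
    by (intro bexI[of _ "cball s \<rho>"]) (auto simp: unit_sphere_def)
qed

definition cone_over :: "'a::real_vector set \<Rightarrow> 'a set" where
  "cone_over K = {t *\<^sub>R k | t k. 0 < t \<and> k \<in> K}"

lemma cone_over_scale: "p \<in> cone_over K \<Longrightarrow> 0 < r \<Longrightarrow> r *\<^sub>R p \<in> cone_over K"
  unfolding cone_over_def by clarsimp (metis mult_pos_pos)

lemma subset_cone_over: "K \<subseteq> cone_over K"
  unfolding cone_over_def by (force intro: exI[of _ 1])

text \<open>Geodesic convexity on the sphere is convexity of the cone over the set. The geodesic from \<open>k\<close> to \<open>k'\<close> is
  \<open>(sin (l - s) k + sin s k') / sin l\<close>, and \<open>crossing_point\<close> finds the parameter at which it meets the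
  ray through \<open>p + q\<close>. The hemisphere excludes \<open>k' = - k\<close>.\<close>

lemma cone_over_add:
  assumes K: "geo_convex unit_sphere K" "in_open_hemisphere K"
    and p: "p \<in> cone_over K" and q: "q \<in> cone_over K"
  shows "p + q \<in> cone_over K"
proof -
  obtain t k where k: "p = t *\<^sub>R k" "0 < t" "k \<in> K" using p by (auto simp: cone_over_def)
  obtain t' k' where k': "q = t' *\<^sub>R k'" "0 < t'" "k' \<in> K" using q by (auto simp: cone_over_def)
  show ?thesis
  proof (cases "k = k'")
    case True
    then have "p + q = (t + t') *\<^sub>R k" using k k' by (simp add: scaleR_left_distrib)
    then show ?thesis using k k' unfolding cone_over_def by (auto intro: add_pos_pos) 
  next
    case False
    have nk: "k \<bullet> k = 1" "k' \<bullet> k' = 1" using K(1) k k'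
      by (auto simp: geo_convex_def unit_sphere_def dot_square_norm)
    obtain w where w: "0 < w \<bullet> k" "0 < w \<bullet> k'" using K(2) k(3) k'(3) by (auto simp: in_open_hemisphere_def)
    have "0 < (k - k') \<bullet> (k - k')" using False by simp
    then have c1: "k \<bullet> k' < 1" by (simp add: inner_diff nk inner_commute)
    have "0 < w \<bullet> (k + k')" using w by (simp add: inner_add_right)
    then have "k + k' \<noteq> 0" by auto
    then have "0 < (k + k') \<bullet> (k + k')" by simp
    then have c2: "- 1 < k \<bullet> k'" by (simp add: inner_add nk inner_commute)
    define l where "l = arccos (k \<bullet> k')"
    have l: "0 < l" "l < pi" and cl: "cos l = k \<bullet> k'"
      unfolding l_def using arccos_lt_bounded[OF c2 c1] c1 c2 by auto
    have sl: "0 < sin l" using l by (rule sin_gt_zero)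
    define \<gamma> where "\<gamma> s = (sin (l - s) / sin l) *\<^sub>R k + (sin s / sin l) *\<^sub>R k'" for s
    have \<gamma>\<gamma>: "\<gamma> s \<bullet> \<gamma> r = cos (s - r)" for s r
    proof -
      have "sin (l - s) * sin (l - r) + sin s * sin r + (sin (l - s) * sin r + sin s * sin (l - r)) * cos l
          = sin s * sin r * (1 - cos l ^ 2) + cos s * cos r * sin l ^ 2"
        by (simp add: sin_diff algebra_simps power2_eq_square)
      also have "\<dots> = cos (s - r) * sin l ^ 2"
        by (simp add: cos_squared_eq cos_diff algebra_simps)
      finally have "(sin (l - s) * sin (l - r) + sin s * sin r + (sin (l - s) * sin r + sin s * sin (l - r)) * cos l) / sin l ^ 2 = cos (s - r)"
        using sl by simp
      moreover have "\<gamma> s \<bullet> \<gamma> r = (sin (l - s) * sin (l - r) + sin s * sin r + (sin (l - s) * sin r + sin s * sin (l - r)) * cos l) / sin l ^ 2"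
        unfolding \<gamma>_def cl
        by (simp add: inner_add_left inner_add_right nk inner_commute[of k' k] add_divide_distrib power2_eq_square algebra_simps)
      ultimately show ?thesis by simp
    qed
    have "geodesic unit_sphere k k' \<gamma>"
      unfolding geodesic_def Let_def
    proof (intro conjI ballI)
      have d: "dist_fun unit_sphere k k' = l" by (simp add: l_def unit_sphere_def)
      show "\<gamma> 0 = k" "\<gamma> (dist_fun unit_sphere k k') = k'" using sl by (auto simp: \<gamma>_def d)
      show "\<gamma> ` {0..dist_fun unit_sphere k k'} \<subseteq> points unit_sphere"
        using \<gamma>\<gamma> by (auto simp: unit_sphere_def norm_eq_1)
      fix s r assume "s \<in> {0..dist_fun unit_sphere k k'}" "r \<in> {0..dist_fun unit_sphere k k'}"
      then have "\<bar>s - r\<bar> \<le> pi" using l unfolding d by auto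
      then have "arccos (cos \<bar>s - r\<bar>) = \<bar>s - r\<bar>" by (intro arccos_cos) auto
      then show "dist_fun unit_sphere (\<gamma> s) (\<gamma> r) = \<bar>s - r\<bar>" by (simp add: unit_sphere_def \<gamma>\<gamma>)
    qed
    then have \<gamma>K: "\<gamma> ` {0..l} \<subseteq> K"
      using K(1) k(3) k'(3) unfolding geo_convex_def by (force simp: l_def unit_sphere_def)
    obtain s where s: "0 \<le> s" "s \<le> l" "t * sin s = t' * sin (l - s)"
      by (rule crossing_point[of sin l t t']) (use k k' l sl in \<open>auto intro!: continuous_intros\<close>)
    define \<sigma> where "\<sigma> = sin (l - s) + sin s"
    have \<sigma>: "0 < \<sigma>"
    proof (cases "s = 0")
      case True then show ?thesis using sl by (simp add: \<sigma>_def)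
    next
      case False
      then show ?thesis using s l unfolding \<sigma>_def by (intro add_nonneg_pos sin_gt_zero sin_ge_zero) auto
    qed
    define m where "m = (t + t') * sin l / \<sigma>"
    have "t * \<sigma> = (t + t') * sin (l - s)" "t' * \<sigma> = (t + t') * sin s"
      using s(3) by (simp_all add: \<sigma>_def algebra_simps)
    then have "(t + t') * sin (l - s) / \<sigma> = t" "(t + t') * sin s / \<sigma> = t'"
      using \<sigma> by (metis nonzero_mult_div_cancel_right less_irrefl)+
    moreover have "m * (c / sin l) = (t + t') * c / \<sigma>" for c
      using sl by (simp add: m_def)
    ultimately have "m * (sin (l - s) / sin l) = t" "m * (sin s / sin l) = t'" by simp_all
    then have "p + q = m *\<^sub>R \<gamma> s" unfolding \<gamma>_def k k' scaleR_add_right scaleR_scaleR by simp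
    moreover have "0 < m" using k k' sl \<sigma> by (simp add: m_def)
    moreover have "\<gamma> s \<in> K" using \<gamma>K s by auto
    ultimately show ?thesis unfolding cone_over_def by blast
  qed
qed

lemma sum_in_cone_over:
  assumes K: "geo_convex unit_sphere K" "in_open_hemisphere K"
    and F: "finite F" "F \<subseteq> K" "\<And>x. x \<in> F \<Longrightarrow> 0 \<le> w x"
  shows "(\<Sum>x\<in>F. w x *\<^sub>R x) \<in> insert 0 (cone_over K)"
  using F
proof (induction F)
  case (insert x F)
  then have "w x *\<^sub>R x \<in> insert 0 (cone_over K)"
    using subset_cone_over[of K] cone_over_scale[of x K "w x"] by (cases "w x = 0") (auto simp: less_le)
  then show ?case using insert cone_over_add[OF K] by auto
qed simp

text \<open>The centre \<open>u\<close> is the direction of the point \<open>p\<close> of the convex hull nearest to the origin, since then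
  \<open>p \<bullet> x \<ge> p \<bullet> p\<close> on \<open>K\<close>; what has to be shown is that \<open>p\<close> is not short. By Caratheodory \<open>p\<close> is a convex
  combination of at most four points, so one point \<open>x\<close> of \<open>K\<close> has weight \<open>w \<ge> 1 / 4\<close>, and the other terms add up to a
  multiple \<open>t k\<close> of a single point of \<open>K\<close> by convexity. As the angle between \<open>x\<close> and \<open>k\<close> is at most
  \<open>D\<close>, the vector \<open>w x + t k\<close> has length at least \<open>w sin D\<close>: in the extreme
  case this is the distance of \<open>w x\<close> from the line through \<open>k\<close>.\<close>

lemma spherical_body_in_cap:
  assumes K: "geo_convex unit_sphere K" "in_open_hemisphere K" "compact K" "K \<noteq> {}"
    and D: "0 < D" "D < pi" and diam: "\<And>x y. x \<in> K \<Longrightarrow> y \<in> K \<Longrightarrow> cos D \<le> x \<bullet> y"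
  obtains u where "norm u = 1" "\<And>x. x \<in> K \<Longrightarrow> sin D / 4 \<le> u \<bullet> x"
proof -
  define p where "p = closest_point (convex hull K) 0"
  have comp: "compact (convex hull K)" using K(3) by (rule compact_convex_hull)
  have ne: "convex hull K \<noteq> {}" using K(4) by simp
  have p: "p \<in> convex hull K"
    unfolding p_def using closest_point_in_set[OF compact_imp_closed[OF comp] ne] .
  have pp: "p \<bullet> p \<le> p \<bullet> x" if "x \<in> K" for x
    using closest_point_dot[OF convex_convex_hull compact_imp_closed[OF comp] hull_inc[OF that], of 0]
    by (simp add: p_def inner_diff_right)
  have unit: "x \<bullet> x = 1" if "x \<in> K" for x
    using K(1) that by (auto simp: geo_convex_def unit_sphere_def dot_square_norm)
  obtain S where S: "finite S" "S \<subseteq> K" "card S \<le> 4" "p \<in> convex hull S"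
    using p by (subst (asm) caratheodory) auto
  then obtain w where w: "\<And>x. x \<in> S \<Longrightarrow> 0 \<le> w x" "sum w S = 1" "(\<Sum>x\<in>S. w x *\<^sub>R x) = p"
    unfolding convex_hull_finite[OF S(1)] by auto
  obtain x where x: "x \<in> S" "1 / 4 \<le> w x"
  proof (rule ccontr)
    assume "\<not> thesis"
    then have "w x < 1 / 4" if "x \<in> S" for x using that \<open>\<And>x. x \<in> S \<Longrightarrow> 1 / 4 \<le> w x \<Longrightarrow> thesis\<close> by force
    moreover have "S \<noteq> {}" using w(2) by auto
    ultimately have "sum w S < (\<Sum>x\<in>S. 1 / 4)" using S(1) by (intro sum_strict_mono) auto
    also have "\<dots> \<le> 1" using S(3) by simp
    finally show False using w(2) by simp
  qed
  have xK: "x \<in> K" using x S by auto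
  define q where "q = (\<Sum>y\<in>S - {x}. w y *\<^sub>R y)"
  have pq: "p = w x *\<^sub>R x + q" unfolding q_def w(3)[symmetric] using sum.remove[OF S(1) x(1)] .
  have "q \<in> insert 0 (cone_over K)"
    unfolding q_def using S w(1) by (intro sum_in_cone_over[OF K(1,2)]) auto
  then obtain t k where t: "0 \<le> t" "k \<in> K" "q = t *\<^sub>R k"
  proof (cases "q = 0")
    case True
    then show ?thesis using that[of 0 x] xK by simp
  next
    case False
    assume "q \<in> insert 0 (cone_over K)"
    then show ?thesis using False that unfolding cone_over_def by (auto intro: less_imp_le)
  qed
  let ?a = "w x"
  have "(sin D / 4)\<^sup>2 \<le> (?a * sin D)\<^sup>2"
    using x(2) D sin_gt_zero[of D] by (intro power_mono) auto
  also have "\<dots> \<le> (t + ?a * cos D)\<^sup>2 + (?a * sin D)\<^sup>2" by simp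
  also have "\<dots> = t\<^sup>2 + ?a\<^sup>2 * ((cos D)\<^sup>2 + (sin D)\<^sup>2) + 2 * ?a * t * cos D"
    by algebra
  also have "\<dots> \<le> t\<^sup>2 + ?a\<^sup>2 + 2 * ?a * t * (x \<bullet> k)"
    using diam[OF xK t(2)] t(1) x(2) by (simp add: mult_left_mono)
  also have "\<dots> = p \<bullet> p"
    unfolding pq t(3) using unit[OF xK] unit[OF t(2)]
    by (simp add: inner_add_left inner_add_right inner_commute[of k x] power2_eq_square algebra_simps)
  finally have "(sin D / 4)\<^sup>2 \<le> (norm p)\<^sup>2" by (simp add: dot_square_norm)
  then have np: "sin D / 4 \<le> norm p" by (simp add: power2_le_iff_abs_le)
  have "0 < sin D" using D by (intro sin_gt_zero)
  then have n0: "0 < norm p" using np by linarith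
  show ?thesis
  proof (rule that[of "p /\<^sub>R norm p"])
    show "norm (p /\<^sub>R norm p) = 1" using n0 by simp
    fix x assume "x \<in> K"
    have "norm p * norm p \<le> p \<bullet> x" using pp[OF \<open>x \<in> K\<close>] by (simp add: dot_square_norm power2_eq_square)
    then have "norm p \<le> (p \<bullet> x) / norm p" using n0 by (simp add: pos_le_divide_eq)
    also have "\<dots> = (p /\<^sub>R norm p) \<bullet> x" by (simp add: field_simps)
    finally show "sin D / 4 \<le> (p /\<^sub>R norm p) \<bullet> x" using np by linarith
  qed
qed

lemma norm_diff_le_arccos:
  assumes "norm x = 1" "norm y = 1"
  shows "norm (x - y) \<le> arccos (x \<bullet> y)"
proof -
  have xy: "\<bar>x \<bullet> y\<bar> \<le> 1" using Cauchy_Schwarz_ineq2[of x y] assms by simp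
  define d where "d = arccos (x \<bullet> y)"
  have d: "cos d = x \<bullet> y" "0 \<le> d" using xy by (auto simp: d_def abs_le_iff arccos_lbound)
  have "x \<bullet> x = 1" "y \<bullet> y = 1" using assms by (simp_all add: dot_square_norm)
  then have "(norm (x - y))\<^sup>2 = 2 - 2 * cos d"
    unfolding power2_norm_eq_inner by (simp add: d inner_diff inner_commute)
  also have "\<dots> = (2 * \<bar>sin (d / 2)\<bar>)\<^sup>2" using cos_double_sin[of "d / 2"] by (simp add: power_mult_distrib)
  also have "\<dots> \<le> d\<^sup>2" using abs_sin_x_le_abs_x[of "d / 2"] d by (intro power_mono) auto
  finally show ?thesis using d(2) by (simp add: d_def power2_le_iff_abs_le)
qed

text \<open>The chart is central projection to the tangent plane at the centre \<open>u\<close> of the cap from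
  \<open>spherical_body_in_cap\<close>, after a rotation \<open>T\<close> taking \<open>u\<close> to the third axis: \<open>X x\<close> is the projected
  point and \<open>f x\<close> its two coordinates. The cap has \<open>u \<bullet> x \<ge> sin D / 4\<close> on \<open>K\<close>; moving by less than
  \<open>sin D / 8\<close> leaves half of this on \<open>L\<close>, which bounds the distortion of the projection.\<close>

lemma spherical_case:
  assumes K: "spherical_convex_body K" and L: "spherical_convex_body L"
    and D: "0 < D" "D < pi" and diam: "diam unit_sphere K \<le> D"
    and less: "hausdorff_dist unit_sphere K L < sin D / 8"
  defines "\<eta> \<equiv> sin D / 8"
  shows "symm_diff_dist unit_sphere K L \<le>
    (72 * 12288 * (2 * (1 / \<eta>) + 2 / \<eta>\<^sup>2) * (2 / \<eta>\<^sup>2)) * hausdorff_dist unit_sphere K L"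
proof -
  let ?d = "dist_fun unit_sphere"
  have K': "geo_convex unit_sphere K" "in_open_hemisphere K" "compact K" "K \<noteq> {}"
    and L': "geo_convex unit_sphere L" "in_open_hemisphere L" "compact L" "L \<noteq> {}"
    using K L by (auto simp: spherical_convex_body_def convex_body_def interior_of_def)
  have unit: "norm x = 1" if "x \<in> K \<union> L" for x
    using K'(1) L'(1) that by (auto simp: geo_convex_def unit_sphere_def)
  have dot: "\<bar>x \<bullet> y\<bar> \<le> 1" if "x \<in> K \<union> L" "y \<in> K \<union> L" for x y
    using Cauchy_Schwarz_ineq2[of x y] unit[OF that(1)] unit[OF that(2)] by simp
  have pos: "0 \<le> ?d x y" and E: "?d x y \<le> pi" if "x \<in> K \<union> L" "y \<in> K \<union> L" for x y
    using dot[OF that] by (auto simp: unit_sphere_def abs_le_iff intro: arccos_lbound arccos_ubound)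
  have dist: "norm (x - y) \<le> ?d x y" if "x \<in> K \<union> L" "y \<in> K \<union> L" for x y
    using norm_diff_le_arccos[OF unit[OF that(1)] unit[OF that(2)]] by (simp add: unit_sphere_def)
  have "cos D \<le> x \<bullet> y" if xy: "x \<in> K" "y \<in> K" for x y
  proof -
    have "?d x y \<le> D" using dist_le_diam[OF xy, of unit_sphere pi] E diam by force
    then have "cos D \<le> cos (?d x y)" using D pos[of x y] xy by (subst cos_mono_le_eq) auto
    then show ?thesis using dot[of x y] xy by (simp add: unit_sphere_def abs_le_iff)
  qed
  then obtain u where u: "norm u = 1" "\<And>x. x \<in> K \<Longrightarrow> sin D / 4 \<le> u \<bullet> x"
    using spherical_body_in_cap[OF K' D] by blast
  have \<eta>: "0 < \<eta>" "\<eta> \<le> 1"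
    using sin_gt_zero[OF D] order_trans[OF sin_le_one[of D], of 8] by (auto simp: \<eta>_def)
  have cap: "\<eta> \<le> u \<bullet> x" if "x \<in> K \<union> L" for x
  proof (cases "x \<in> K")
    case True then show ?thesis using u(2)[OF True] \<eta> by (simp add: \<eta>_def)
  next
    case False
    then have xL: "x \<in> L" using that by simp
    obtain y where y: "y \<in> K" "?d x y < \<eta>"
      using hausdorff_dist_near(2)[OF K'(4) L'(4) pos E less xL] by (auto simp: \<eta>_def)
    then have "norm (y - x) \<le> \<eta>" using dist[of x y] that by (simp add: norm_minus_commute)
    then have "u \<bullet> (y - x) \<le> \<eta>" using norm_cauchy_schwarz[of u "y - x"] u(1) by simp
    then show ?thesis using u(2)[OF y(1)] by (simp add: inner_diff_right \<eta>_def)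
  qed
  obtain T :: "real^3 \<Rightarrow> real^3" where T: "orthogonal_transformation T" "T u = axis 3 1"
    using orthogonal_transformation_exists[of u "axis 3 1 :: real^3"] u(1) by (auto simp: norm_axis_1)
  have lin: "linear T" using T(1) by (rule orthogonal_transformation_linear)
  have T3: "T x $ 3 = u \<bullet> x" for x
  proof -
    have "T u \<bullet> T x = u \<bullet> x" using T(1) by (simp add: orthogonal_transformation_def)
    then show ?thesis by (simp add: T(2) inner_axis')
  qed
  have nT: "norm (T x) = norm x" for x using orthogonal_transformation_norm[OF T(1)] .
  have Tsub: "T x - T y = T (x - y)" for x y using linear_diff[OF lin] by simp
  have x3: "\<eta> \<le> T x $ 3" if "x \<in> K \<union> L" for x using cap[OF that] by (simp add: T3)
  have x30: "0 < T x $ 3" if "x \<in> K \<union> L" for x using x3[OF that] \<eta> by simp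
  define X where "X x = (1 / T x $ 3) *\<^sub>R T x" for x
  define f where "f x = (X x $ 1, X x $ 2)" for x
  have X3: "X x $ 3 = 1" if "x \<in> K \<union> L" for x using x30[OF that] by (simp add: X_def)
  have TX: "T x = (T x $ 3) *\<^sub>R X x" and nX: "norm (X x) = 1 / T x $ 3" if "x \<in> K \<union> L" for x
    using x30[OF that] unit[OF that] by (simp_all add: X_def nT)
  \<comment> \<open>The sphere point is \<open>X x\<close> scaled to norm 1, and radial projection to the sphere is Lipschitz outside the ball.\<close>
  have inverse_lip: "norm (x - y) \<le> 2 * norm (X x - X y)" if xy: "x \<in> K \<union> L" "y \<in> K \<union> L" for x y
  proof -
    let ?a = "T x $ 3" and ?b = "T y $ 3"
    have ab: "0 < ?a" "0 < ?b" using x30 xy by auto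
    have a1: "?a \<le> 1" using component_le_norm_cart[of "T x" 3] unit[OF xy(1)] by (simp add: nT)
    have "T (x - y) = ?a *\<^sub>R (X x - X y) + (?a - ?b) *\<^sub>R X y"
      unfolding Tsub[symmetric] by (subst TX[OF xy(1)], subst TX[OF xy(2)]) (simp add: algebra_simps)
    then have "norm (x - y) \<le> ?a * norm (X x - X y) + \<bar>?a - ?b\<bar> * norm (X y)"
      using norm_triangle_ineq[of "?a *\<^sub>R (X x - X y)" "(?a - ?b) *\<^sub>R X y"] ab nT[of "x - y"] by simp
    also have "\<bar>?a - ?b\<bar> * norm (X y) = ?a * \<bar>norm (X x) - norm (X y)\<bar>"
    proof -
      have "\<bar>?a - ?b\<bar> * norm (X y) = \<bar>(?a - ?b) / ?b\<bar>" using ab by (simp add: nX[OF xy(2)] abs_divide)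
      also have "(?a - ?b) / ?b = - (?a * (1 / ?a - 1 / ?b))" using ab by (simp add: field_simps)
      also have "\<bar>\<dots>\<bar> = ?a * \<bar>norm (X x) - norm (X y)\<bar>" unfolding abs_minus_cancel abs_mult using ab by (simp add: nX[OF xy(1)] nX[OF xy(2)])
      finally show ?thesis .
    qed
    also have "\<dots> \<le> ?a * norm (X x - X y)" using ab by (intro mult_left_mono norm_triangle_ineq3) auto
    also have "?a * norm (X x - X y) \<le> 1 * norm (X x - X y)" using a1 by (intro mult_right_mono) auto
    finally show ?thesis by simp
  qed
  have planar: "norm (X x - X y) \<le> 2 * r" if xy: "x \<in> K \<union> L" "y \<in> K \<union> L" "chart_close f r x y" for x y r
    using norm_le_l1_cart[of "X x - X y"] xy(3) X3[OF xy(1)] X3[OF xy(2)]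
    by (simp add: sum_3 chart_close_def f_def)
  have conv: "convex (f ` A)" if A: "geo_convex unit_sphere A" "in_open_hemisphere A" "A \<subseteq> K \<union> L" for A
    unfolding convex_def
  proof (intro ballI allI impI)
    fix P Q and a b :: real
    assume "P \<in> f ` A" "Q \<in> f ` A" and ab: "0 \<le> a" "0 \<le> b" "a + b = 1"
    then obtain x y where x: "x \<in> A" "P = f x" and y: "y \<in> A" "Q = f y" by auto
    have p: "0 < T x $ 3" "0 < T y $ 3" using x30 A(3) x y by auto
    \<comment> \<open>In the cone over \<open>A\<close>, scaled so that its projection is the given point of the segment.\<close>
    define v where "v = (a / T x $ 3) *\<^sub>R x + (b / T y $ 3) *\<^sub>R y"
    have "v \<in> cone_over A"
    proof (cases "a = 0 \<or> b = 0")
      case True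
      moreover have "(1 / T x $ 3) *\<^sub>R x \<in> cone_over A" "(1 / T y $ 3) *\<^sub>R y \<in> cone_over A"
        using p x y by (auto intro: cone_over_scale subsetD[OF subset_cone_over])
      ultimately show ?thesis using ab(3) unfolding v_def by auto
    next
      case False
      then show ?thesis using ab p x y unfolding v_def
        by (intro cone_over_add[OF A(1,2)] cone_over_scale subsetD[OF subset_cone_over]) auto
    qed
    then obtain t z where z: "0 < t" "z \<in> A" "v = t *\<^sub>R z" by (auto simp: cone_over_def)
    have Tv: "T v = a *\<^sub>R X x + b *\<^sub>R X y"
      unfolding v_def X_def by (simp add: linear_add[OF lin] linear_scale[OF lin])
    have "T v $ 3 = 1" unfolding Tv using X3 A(3) x y ab by (simp add: subset_iff)
    moreover have "T v = t *\<^sub>R T z" unfolding z(3) by (rule linear_scale[OF lin])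
    ultimately have "T z $ 3 = 1 / t" "T v = t *\<^sub>R T z" using z(1) by (auto simp: field_simps)
    then have "X z = T v" by (simp add: X_def)
    then have "a *\<^sub>R P + b *\<^sub>R Q = f z" by (simp add: f_def x y Tv)
    then show "a *\<^sub>R P + b *\<^sub>R Q \<in> f ` A" using z by auto
  qed
  have compare: "\<bar>X x $ i - X y $ i\<bar> \<le> 2 / \<eta>\<^sup>2 * ?d x y" if xy: "x \<in> K \<union> L" "y \<in> K \<union> L" for x y i
  proof -
    let ?a = "T x $ 3" and ?b = "T y $ 3" and ?e = "norm (x - y)"
    have ab: "\<eta> \<le> ?a" "\<eta> \<le> ?b" "0 < ?a" "0 < ?b" using x3 x30 xy by auto
    have comp: "\<bar>T x $ j - T y $ j\<bar> \<le> ?e" for j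
      using component_le_norm_cart[of "T x - T y" j] unfolding Tsub nT by (simp flip: Tsub)
    have y1: "\<bar>T y $ i\<bar> \<le> 1" using component_le_norm_cart[of "T y" i] unit[OF xy(2)] by (simp add: nT)
    have "X x $ i - X y $ i = (T x $ i - T y $ i) / ?a - T y $ i * (?a - ?b) / (?a * ?b)"
      using ab by (simp add: X_def field_simps)
    then have "\<bar>X x $ i - X y $ i\<bar> \<le> \<bar>T x $ i - T y $ i\<bar> / ?a + \<bar>T y $ i\<bar> * \<bar>?a - ?b\<bar> / (?a * ?b)"
      using abs_triangle_ineq4[of "(T x $ i - T y $ i) / ?a" "T y $ i * (?a - ?b) / (?a * ?b)"] ab
      by (simp add: abs_mult abs_divide)
    also have "\<dots> \<le> ?e / (\<eta> * \<eta>) + 1 * ?e / (\<eta> * \<eta>)"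
    proof (intro add_mono frac_le mult_mono comp y1)
      show "\<eta> * \<eta> \<le> ?a" using mult_mono[of \<eta> 1 \<eta> ?a] ab \<eta> by simp
    qed (use ab \<eta> in auto)
    also have "\<dots> = 2 / \<eta>\<^sup>2 * ?e" by (simp add: power2_eq_square)
    also have "\<dots> \<le> 2 / \<eta>\<^sup>2 * ?d x y" using dist[OF xy] by (intro mult_left_mono) auto
    finally show ?thesis .
  qed
  show ?thesis
  proof (rule symm_diff_dist_bound[where f = f and E = pi])
    show "inj_on f (K \<union> L)"
    proof (rule inj_onI)
      fix x y assume xy: "x \<in> K \<union> L" "y \<in> K \<union> L" "f x = f y"
      then have "chart_close f 0 x y" by (simp add: chart_close_def)
      then show "x = y" using planar[OF xy(1,2), of 0] inverse_lip[OF xy(1,2)] by simp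
    qed
    show "\<bar>fst (f z)\<bar> \<le> 1 / \<eta> \<and> \<bar>snd (f z)\<bar> \<le> 1 / \<eta>" if "z \<in> K \<union> L" for z
    proof -
      have "norm (X z) \<le> 1 / \<eta>" using x3[OF that] x30[OF that] \<eta> nX[OF that] by (simp add: frac_le)
      then show ?thesis using component_le_norm_cart[of "X z"] order_trans by (auto simp: f_def) 
    qed
    show "chart_close f (2 / \<eta>\<^sup>2 * ?d x y) x y" if "x \<in> K \<union> L" "y \<in> K \<union> L" for x y
      using compare[OF that] by (simp add: chart_close_def f_def)
    show "covered_within (area_measure unit_sphere) (12288 * r\<^sup>2) S"
      if S: "S \<subseteq> K \<union> L" "0 < r" "\<forall>x\<in>S. \<forall>y\<in>S. chart_close f r x y" for S r
    proof -
      have "dist x y \<le> 4 * r" if "x \<in> S" "y \<in> S" for x y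
        using inverse_lip[of x y] planar[of x y r] S that unfolding dist_norm by force
      then have "covered_within (area_measure unit_sphere) (768 * (4 * r)\<^sup>2) S"
        using S(2) by (intro spherical_small_set_covered) auto
      then show ?thesis by (simp add: power_mult_distrib)
    qed
    show "K \<in> sets (area_measure unit_sphere)" "L \<in> sets (area_measure unit_sphere)"
      using K' L' by (auto simp: unit_sphere_def borel_compact)
    show "hausdorff_dist unit_sphere K L < 1" using less \<eta> by (simp add: \<eta>_def)
  qed (use K' L' \<eta> pos E conv in auto)
qed

section \<open>The three planes together\<close>

theorem lemma1p3:
  shows "(\<forall>D::real. 0 < D \<longrightarrow>
           (\<exists>\<epsilon>>0. \<exists>c>0. \<forall>K L.
              convex_body euclidean_plane K \<and> convex_body euclidean_plane L \<and>
              max (diam euclidean_plane K) (diam euclidean_plane L) = D \<and>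
              hausdorff_dist euclidean_plane K L < \<epsilon> \<longrightarrow>
              symm_diff_dist euclidean_plane K L \<le> c * hausdorff_dist euclidean_plane K L)) \<and>
         (\<forall>D::real. 0 < D \<longrightarrow>
           (\<exists>\<epsilon>>0. \<exists>c>0. \<forall>K L.
              convex_body hyperbolic_plane K \<and> convex_body hyperbolic_plane L \<and>
              max (diam hyperbolic_plane K) (diam hyperbolic_plane L) = D \<and>
              hausdorff_dist hyperbolic_plane K L < \<epsilon> \<longrightarrow>
              symm_diff_dist hyperbolic_plane K L \<le> c * hausdorff_dist hyperbolic_plane K L)) \<and>
         (\<forall>D::real. 0 < D \<and> D < pi \<longrightarrow>
           (\<exists>\<epsilon>>0. \<exists>c>0. \<forall>K L.
              spherical_convex_body K \<and> spherical_convex_body L \<and>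
              in_open_hemisphere (K \<union> L) \<and>
              max (diam unit_sphere K) (diam unit_sphere L) = D \<and>
              hausdorff_dist unit_sphere K L < \<epsilon> \<longrightarrow>
              symm_diff_dist unit_sphere K L \<le> c * hausdorff_dist unit_sphere K L))"
proof (intro conjI allI impI)
  fix D :: real assume D: "0 < D"
  show "\<exists>\<epsilon>>0. \<exists>c>0. \<forall>K L.
      convex_body euclidean_plane K \<and> convex_body euclidean_plane L \<and>
      max (diam euclidean_plane K) (diam euclidean_plane L) = D \<and>
      hausdorff_dist euclidean_plane K L < \<epsilon> \<longrightarrow>
      symm_diff_dist euclidean_plane K L \<le> c * hausdorff_dist euclidean_plane K L"
    by (rule exI[of _ 1], simp, rule exI[of _ "288 * (2 * (D + 1) + 1)"])
       (use D euclidean_case[of _ _ D] in auto)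
next
  fix D :: real assume D: "0 < D"
  define M where "M = 8 * cosh D * cosh 1"
  have M: "0 < M" by (simp add: M_def)
  show "\<exists>\<epsilon>>0. \<exists>c>0. \<forall>K L.
      convex_body hyperbolic_plane K \<and> convex_body hyperbolic_plane L \<and>
      max (diam hyperbolic_plane K) (diam hyperbolic_plane L) = D \<and>
      hausdorff_dist hyperbolic_plane K L < \<epsilon> \<longrightarrow>
      symm_diff_dist hyperbolic_plane K L \<le> c * hausdorff_dist hyperbolic_plane K L"
  proof (rule exI[of _ 1], simp, rule exI[of _ "72 * (36 * M ^ 6) * (2 * (2 * M\<^sup>2) + 8 * M\<^sup>2) * (8 * M\<^sup>2)"], intro conjI)
    show "0 < 72 * (36 * M ^ 6) * (2 * (2 * M\<^sup>2) + 8 * M\<^sup>2) * (8 * M\<^sup>2)" using M by (simp add: add_pos_pos)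
  qed (use hyperbolic_case[of _ _ D, folded M_def] in auto)
next
  fix D :: real assume D: "0 < D \<and> D < pi"
  define \<eta> where "\<eta> = sin D / 8"
  have \<eta>: "0 < \<eta>" using D by (simp add: \<eta>_def sin_gt_zero)
  show "\<exists>\<epsilon>>0. \<exists>c>0. \<forall>K L.
      spherical_convex_body K \<and> spherical_convex_body L \<and> in_open_hemisphere (K \<union> L) \<and>
      max (diam unit_sphere K) (diam unit_sphere L) = D \<and>
      hausdorff_dist unit_sphere K L < \<epsilon> \<longrightarrow>
      symm_diff_dist unit_sphere K L \<le> c * hausdorff_dist unit_sphere K L"
  proof (rule exI[of _ \<eta>], intro conjI \<eta>,
      rule exI[of _ "72 * 12288 * (2 * (1 / \<eta>) + 2 / \<eta>\<^sup>2) * (2 / \<eta>\<^sup>2)"], intro conjI)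
    show "0 < 72 * 12288 * (2 * (1 / \<eta>) + 2 / \<eta>\<^sup>2) * (2 / \<eta>\<^sup>2)" using \<eta> by (simp add: add_pos_pos)
  qed (use D spherical_case[of _ _ D, folded \<eta>_def] in auto)
qed

end
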